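(* Let $n\ge3$. For any $c\in W_{A_{2n-1}^{(2)}}^0=\mathcal C_{2n}^{s,p}$, we have $$L_{A_{2n-1}^{(2)}}(c)=L_{A_{2n}^{(2)}}(c)-a_0^{A_{2n}^{(2)}}(c)=\frac12\big(L(c)-a_0(c)\big).$$
   Context: A $2n$-core is a partition having no hook length equal to $2n$; $\mathcal C_{2n}$ is the set of $2n$-cores, $\mathcal C_{2n}^s$ the subset of self-conjugate ones, and $\mathcal C_{2n}^{s,p}$ the subset of $\mathcal C_{2n}^s$ of cores with an even number of boxes on the main diagonal. The box in row $i$, column $j$ has residue $(j-i)\bmod 2n$; boxes of residue $i$ are $i$-nodes. The affine Weyl group $\widetilde{\mathfrak S}_{2n}$ of type $A_{2n-1}^{(1)}$, with simple reflections $s_0,\dots,s_{2n-1}$, acts on $\mathcal C_{2n}$: $s_i\cdot c$ is obtained by removing all removable $i$-nodes of $c$ if there are some, adding all addable $i$-nodes if there are some, and $s_i\cdot c=c$ otherwise. $L(c)$ is the number of boxes of $c$ and $a_i(c)$ the number of boxes of residue $i$. Let $\alpha_0,\dots,\alpha_{2n-1}$, $\Lambda_0,\dots,\Lambda_{2n-1}$ be the simple roots and fundamental weights of type $A_{2n-1}^{(1)}$, with $\widetilde{\mathfrak S}_{2n}$ acting by $s_i(x)=x-\langle x,\alpha_i^\vee\rangle\alpha_i$. Type $A_{2n}^{(2)}$ is realized by $\alpha_0^{A_{2n}^{(2)}}=\alpha_0$, $\alpha_i^{A_{2n}^{(2)}}=\alpha_i+\alpha_{2n-i}$ ($1\le i\le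 n-1$), $\alpha_n^{A_{2n}^{(2)}}=2\alpha_n$, $\Lambda_0^{A_{2n}^{(2)}}=\Lambda_0$, with Weyl group generated by $s_0$, $s_is_{2n-i}$ ($1\le i\le n-1$), $s_n$. Type $A_{2n-1}^{(2)}$ is realized by $\alpha_i^{A_{2n-1}^{(2)}}=\alpha_i^{A_{2n}^{(2)}}$ ($1\le i\le n$), $\alpha_0^{A_{2n-1}^{(2)}}=2\alpha_0^{A_{2n}^{(2)}}+\alpha_1^{A_{2n}^{(2)}}$, $\Lambda_0^{A_{2n-1}^{(2)}}=\Lambda_0^{A_{2n}^{(2)}}$, with Weyl group $W_{A_{2n-1}^{(2)}}$ generated by $s_0s_1s_{2n-1}s_0$, $s_is_{2n-i}$ ($1\le i\le n-1$), $s_n$. The affine Grassmannian (minimal length representatives of left cosets modulo the finite Weyl group generated by the generators of index $1,\dots,n$) of type $A_{2n}^{(2)}$, resp. $A_{2n-1}^{(2)}$, is identified with $\mathcal C_{2n}^s$, resp. $\mathcal C_{2n}^{s,p}$, via $w\mapsto w\cdot\varnothing$. For $X$ either of these two types and $w$ in its Weyl group with $c=w\cdot\varnothing$, write $\Lambda_0^X-w(\Lambda_0^X)=\sum_{i=0}^n a_i^X(c)\alpha_i^X$ (this depends only on $c$); the atomic length is $L_X(c)=\sum_{i=0}^n a_i^X(c)$. *)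

theory Defs
  imports Complex_Main "HOL-Library.Poly_Mapping"
begin

section \<open>Partitions and cores\<close>

text \<open>
  A partition is identified with its Young diagram, a finite set of boxes (row, column).
  Rows and columns are numbered from 0; residues and hook lengths do not depend on this shift.
\<close>

type_synonym box = "nat \<times> nat"

definition partition_diagram :: "box set \<Rightarrow> bool" where
  "partition_diagram c \<longleftrightarrow>
     finite c \<and> (\<forall>i j i' j'. (i, j) \<in> c \<longrightarrow> i' \<le> i \<longrightarrow> j' \<le> j \<longrightarrow> (i', j') \<in> c)"

definition hook_length :: "box set \<Rightarrow> box \<Rightarrow> nat" where
  "hook_length c b =
     card {j. snd b < j \<and> (fst b, j) \<in> c} + card {i. fst b < i \<and> (i, snd b) \<in> c} + 1"

definition cores :: "nat \<Rightarrow> box set set" where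
  "cores m = {c. partition_diagram c \<and> (\<forall>b\<in>c. hook_length c b \<noteq> m)}"

definition conjugate :: "box set \<Rightarrow> box set" where
  "conjugate c = {(j, i) |i j. (i, j) \<in> c}"

definition self_conjugate_cores :: "nat \<Rightarrow> box set set" where
  "self_conjugate_cores m = {c \<in> cores m. conjugate c = c}"

definition even_self_conjugate_cores :: "nat \<Rightarrow> box set set" where
  "even_self_conjugate_cores m = {c \<in> self_conjugate_cores m. even (card {i. (i, i) \<in> c})}"

definition residue :: "nat \<Rightarrow> box \<Rightarrow> int" where
  "residue n b = (int (snd b) - int (fst b)) mod (2 * int n)"

definition nodes :: "nat \<Rightarrow> nat \<Rightarrow> box set \<Rightarrow> box set" where
  "nodes n i c = {b \<in> c. residue n b = int i}"

definition removable_nodes :: "nat \<Rightarrow> nat \<Rightarrow> box set \<Rightarrow> box set" where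
  "removable_nodes n i c = {b \<in> c. residue n b = int i \<and> partition_diagram (c - {b})}"

definition addable_nodes :: "nat \<Rightarrow> nat \<Rightarrow> box set \<Rightarrow> box set" where
  "addable_nodes n i c = {b. b \<notin> c \<and> residue n b = int i \<and> partition_diagram (insert b c)}"

definition core_reflection :: "nat \<Rightarrow> nat \<Rightarrow> box set \<Rightarrow> box set" where
  "core_reflection n i c =
     (if removable_nodes n i c \<noteq> {} then c - removable_nodes n i c
      else if addable_nodes n i c \<noteq> {} then c \<union> addable_nodes n i c
      else c)"


section \<open>Weights of type \<open>A\<close> with index \<open>2n-1\<close> (untwisted affine)\<close>

text \<open>
  The weight lattice is the free abelian group on the fundamental weights
  \<open>\<Lambda>\<^sub>i\<close> for \<open>0 \<le> i < 2n\<close> and the null root \<open>\<delta>\<close>. The simple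
  coroots are dual to the \<open>\<Lambda>\<^sub>i\<close> and annihilate \<open>\<delta>\<close>.
  The simple roots are the columns of the Cartan matrix, with \<open>\<delta>\<close> added to
  \<open>\<alpha>\<^sub>0\<close>, so that they are linearly independent and sum to \<open>\<delta>\<close>.
\<close>

datatype weight_basis = Fund nat | Null_Root

type_synonym weight = "weight_basis \<Rightarrow>\<^sub>0 int"

definition fundamental_weight :: "nat \<Rightarrow> weight" where
  "fundamental_weight i = frag_of (Fund i)"

definition coroot_pairing :: "weight \<Rightarrow> nat \<Rightarrow> int" where
  "coroot_pairing x i = Poly_Mapping.lookup x (Fund i)"

definition simple_root :: "nat \<Rightarrow> nat \<Rightarrow> weight" where
  "simple_root n i =
     frag_cmul 2 (fundamental_weight i)
     - fundamental_weight ((i + 1) mod (2 * n))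
     - fundamental_weight ((i + 2 * n - 1) mod (2 * n))
     + (if i = 0 then frag_of Null_Root else 0)"

definition weight_reflection :: "nat \<Rightarrow> nat \<Rightarrow> weight \<Rightarrow> weight" where
  "weight_reflection n i x = x - frag_cmul (coroot_pairing x i) (simple_root n i)"

text \<open>
  Elements of the affine Weyl group are given by words in the simple reflections:
  the list \<open>[i\<^sub>1, \<dots>, i\<^sub>k]\<close> stands for the product of the
  reflections with these indices in this order, so the last letter acts first.
\<close>

definition core_action :: "nat \<Rightarrow> nat list \<Rightarrow> box set \<Rightarrow> box set" where
  "core_action n w c = foldr (core_reflection n) w c"

definition weight_action :: "nat \<Rightarrow> nat list \<Rightarrow> weight \<Rightarrow> weight" where
  "weight_action n w x = foldr (weight_reflection n) w x"


section \<open>The twisted types\<close>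

text \<open>
  \<open>A2_even\<close> is the type \<open>A\<close> with lower index \<open>2n\<close> and upper index (2),
  \<open>A2_odd\<close> the type \<open>A\<close> with lower index \<open>2n-1\<close> and upper index (2).
\<close>

datatype twisted_type = A2_even | A2_odd

definition root_A2_even :: "nat \<Rightarrow> nat \<Rightarrow> weight" where
  "root_A2_even n i =
     (if i = 0 then simple_root n 0
      else if i < n then simple_root n i + simple_root n (2 * n - i)
      else frag_cmul 2 (simple_root n n))"

fun twisted_root :: "twisted_type \<Rightarrow> nat \<Rightarrow> nat \<Rightarrow> weight" where
  "twisted_root A2_even n i = root_A2_even n i"
| "twisted_root A2_odd n i =
     (if i = 0 then frag_cmul 2 (root_A2_even n 0) + root_A2_even n 1 else root_A2_even n i)"

fun twisted_fundamental_weight_0 :: "twisted_type \<Rightarrow> weight" where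
  "twisted_fundamental_weight_0 A2_even = fundamental_weight 0"
| "twisted_fundamental_weight_0 A2_odd = fundamental_weight 0"

fun weyl_generators :: "twisted_type \<Rightarrow> nat \<Rightarrow> nat list set" where
  "weyl_generators A2_even n = {[0], [n]} \<union> {[i, 2 * n - i] |i. 1 \<le> i \<and> i \<le> n - 1}"
| "weyl_generators A2_odd n =
     {[0, 1, 2 * n - 1, 0], [n]} \<union> {[i, 2 * n - i] |i. 1 \<le> i \<and> i \<le> n - 1}"

text \<open>
  The generators are involutions, so the products of generators already form the Weyl group.
\<close>

definition weyl_words :: "twisted_type \<Rightarrow> nat \<Rightarrow> nat list set" where
  "weyl_words X n = concat ` lists (weyl_generators X n)"

text \<open>
  The description operator carries two claims: \<open>c\<close> lies in the orbit of the empty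
  partition, and the coefficients do not depend on the choice of \<open>w\<close>.
  Coefficients with index above \<open>n\<close> are fixed to be 0.
\<close>

definition root_coeffs :: "twisted_type \<Rightarrow> nat \<Rightarrow> box set \<Rightarrow> nat \<Rightarrow> int" where
  "root_coeffs X n c =
     (THE a. (\<forall>i>n. a i = 0) \<and>
        (\<exists>w\<in>weyl_words X n. core_action n w {} = c \<and>
           twisted_fundamental_weight_0 X - weight_action n w (twisted_fundamental_weight_0 X)
             = (\<Sum>i\<le>n. frag_cmul (a i) (twisted_root X n i))))"

definition atomic_length :: "twisted_type \<Rightarrow> nat \<Rightarrow> box set \<Rightarrow> int" where
  "atomic_length X n c = (\<Sum>i\<le>n. root_coeffs X n c i)"

end

theory Submission
  imports Defs
begin

text \<open>
  Why the formula holds: acting on \<open>\<Lambda>\<^sub>0\<close> by a word \<open>w\<close> and on the empty diagram by the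
  same word are two descriptions of one process. If \<open>c = w \<cdot> \<emptyset>\<close>, then
  \<open>\<Lambda>\<^sub>0 - w \<Lambda>\<^sub>0 = \<Sum>\<^sub>j a\<^sub>j(c) \<alpha>\<^sub>j\<close>, where \<open>a\<^sub>j(c)\<close> counts the boxes of residue
  \<open>j\<close> (\<open>weight_action_fundamental_weight\<close>). For a self-conjugate \<open>c\<close> the counts satisfy
  \<open>a\<^sub>2\<^sub>n\<^sub>-\<^sub>j = a\<^sub>j\<close>, so the right-hand side regroups into the simple roots of either twisted type.
  The coefficients are \<open>a\<^sub>0, a\<^sub>1, \<dots>, a\<^sub>n\<^sub>-\<^sub>1, a\<^sub>n/2\<close> for \<open>A2_even\<close>. For \<open>A2_odd\<close> the root of
  index 0 is \<open>2\<alpha>\<^sub>0\<close> plus the root of index 1, which changes the first two coefficients to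
  \<open>a\<^sub>0/2\<close> and \<open>a\<^sub>1 - a\<^sub>0/2\<close>. Summing gives \<open>a\<^sub>1 + \<dots> + a\<^sub>n\<^sub>-\<^sub>1 + a\<^sub>n/2\<close> for the odd type and for
  the even type without its index 0, and twice this is the number of boxes of nonzero residue.

  Two claims remain. The coefficients are unique because the simple roots are linearly independent
  (\<open>simple_roots_independent\<close>: a harmonic function on a cycle that vanishes somewhere is zero).
  And \<open>c\<close> must lie in the orbit of the empty diagram under the twisted Weyl group
  (\<open>symmetric_flush_in_even_orbit\<close>, \<open>symmetric_flush_in_odd_orbit\<close>). This is a descent on the
  number of boxes: reflecting at \<open>i\<close> adds \<open>p\<^sub>i\<close> boxes, where \<open>p\<^sub>i\<close> is the pairing of the weight of
  \<open>c\<close> with the coroot of index \<open>i\<close>, and a nonempty core has some \<open>p\<^sub>i < 0\<close>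
  (\<open>negative_weight_pairing\<close>).

  All facts about diagrams are obtained from the lengths of their diagonals. A partition is
  determined by these lengths, consecutive lengths differ by at most 1, and recording where they
  change gives a sequence of beads and gaps indexed by the integers (the Maya diagram). Being a
  core becomes a monotonicity condition on beads, and on such diagrams the reflection \<open>s\<^sub>i\<close> just
  exchanges positions \<open>k - 1\<close> and \<open>k\<close> for all \<open>k \<equiv> i\<close>, equivalently it changes diagonal lengths by
  an affine-linear formula (\<open>diagonal_length_core_reflection\<close>). Involutivity, commutation and
  compatibility with conjugation can then be read off.
\<close>

section \<open>Diagonals and beads of a diagram\<close>

definition content :: "box \<Rightarrow> int" where
  "content b = int (snd b) - int (fst b)"

definition diagonal_length :: "box set \<Rightarrow> int \<Rightarrow> int" where
  "diagonal_length c k = int (card {b \<in> c. content b = k})"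

text \<open>
  The correction for negative \<open>k\<close> makes the values 0 and 1 (\<open>bead_0_or_1\<close>): the value 1 marks a
  vertical step of the boundary path of the diagram, the value 0 a horizontal one. The empty diagram
  has its beads exactly at the negative positions.
\<close>

definition bead :: "box set \<Rightarrow> int \<Rightarrow> int" where
  "bead c k = diagonal_length c k - diagonal_length c (k + 1) + of_bool (k < 0)"

lemma box_set_eqI:
  fixes A B :: "box set"
  assumes "\<And>i j. (i, j) \<in> A \<longleftrightarrow> (i, j) \<in> B"
  shows "A = B"
  using assms by (metis subrelI subset_antisym)

lemma finite_down_closed_eq_lessThan:
  fixes S :: "nat set"
  assumes "finite S" and "\<And>x y. x \<in> S \<Longrightarrow> y \<le> x \<Longrightarrow> y \<in> S"
  shows "S = {..<card S}"
proof -
  define m where "m = (LEAST x. x \<notin> S)"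
  have "\<exists>x. x \<notin> S"
    using assms(1) ex_new_if_finite infinite_UNIV_nat by blast
  then have "m \<notin> S" unfolding m_def by (metis LeastI)
  moreover have "x \<in> S" if "x < m" for x
    using that not_less_Least unfolding m_def by blast
  ultimately have "S = {..<m}"
    using assms(2) by (metis lessThan_iff linorder_not_less subsetI subset_antisym)
  then show ?thesis by simp
qed

lemma partition_diagram_finite: "partition_diagram c \<Longrightarrow> finite c"
  by (simp add: partition_diagram_def)

lemma partition_diagram_down:
  "partition_diagram c \<Longrightarrow> (i, j) \<in> c \<Longrightarrow> i' \<le> i \<Longrightarrow> j' \<le> j \<Longrightarrow> (i', j') \<in> c"
  unfolding partition_diagram_def by blast

text \<open>
  A diagonal of a diagram is an initial segment of the full diagonal, so its length decides which of
  its boxes are present; the position of a box along its diagonal is the minimum of its coordinates.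
\<close>

lemma mem_iff_less_diagonal_length:
  assumes "partition_diagram c"
  shows "(i, j) \<in> c \<longleftrightarrow> int (min i j) < diagonal_length c (int j - int i)"
proof -
  define k where "k = int j - int i"
  define f where "f t = (t + nat (- k), t + nat k)" for t
  define T where "T = {t. f t \<in> c}"
  have inj: "inj f" by (auto simp: f_def inj_def)
  have diag: "{b \<in> c. content b = k} = f ` T"
  proof
    show "{b \<in> c. content b = k} \<subseteq> f ` T"
    proof
      fix b assume b: "b \<in> {b \<in> c. content b = k}"
      have "b = f (min (fst b) (snd b))"
        using b by (cases b) (auto simp: f_def content_def min_def)
      with b show "b \<in> f ` T" by (auto simp: T_def)
    qed
  qed (auto simp: T_def f_def content_def)
  have "finite T"
    unfolding T_def using finite_vimageI[OF partition_diagram_finite[OF assms] inj]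
    by (simp add: vimage_def)
  then have "T = {..<card T}"
    by (rule finite_down_closed_eq_lessThan)
      (auto simp: T_def f_def intro: partition_diagram_down[OF assms])
  moreover have "diagonal_length c k = int (card T)"
    unfolding diagonal_length_def diag by (simp add: card_image[OF inj_on_subset[OF inj]])
  moreover have "(i, j) = f (min i j)"
    by (auto simp: f_def k_def min_def)
  ultimately show ?thesis
    unfolding k_def[symmetric] by (metis T_def lessThan_iff mem_Collect_eq of_nat_less_iff)
qed

lemma diagonal_length_nonneg: "0 \<le> diagonal_length c k"
  by (simp add: diagonal_length_def)

lemma diagonal_length_empty [simp]: "diagonal_length {} k = 0"
  by (simp add: diagonal_length_def)

text \<open>
  Neighbouring diagonals interlace: each box of the diagonal further from the centre has a neighbour
  on the nearer one, and at most one box of the nearer diagonal does not arise so.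
\<close>

lemma bead_0_or_1:
  assumes "partition_diagram c"
  shows "bead c k = 0 \<or> bead c k = 1"
proof (cases "k < 0")
  case False
  define t where "t = nat k"
  have k: "k = int t" using False by (simp add: t_def)
  define x y where "x = nat (diagonal_length c k)" and "y = nat (diagonal_length c (k + 1))"
  have x: "diagonal_length c k = int x" and y: "diagonal_length c (k + 1) = int y"
    by (simp_all add: x_def y_def diagonal_length_nonneg)
  have d: "(s, s + t) \<in> c \<longleftrightarrow> s < x" "(s, s + t + 1) \<in> c \<longleftrightarrow> s < y" for s
    using mem_iff_less_diagonal_length[OF assms, of s "s + t"]
      mem_iff_less_diagonal_length[OF assms, of s "s + t + 1"] x y
    by (simp_all add: k add.commute)
  have "y \<le> x"
    using d(1)[of x] d(2)[of x] partition_diagram_down[OF assms, of x "x + t + 1" x "x + t"]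
    by force
  moreover have "x \<le> y + 1"
    using d(1)[of "Suc y"] d(2)[of y]
      partition_diagram_down[OF assms, of "Suc y" "Suc y + t" y "y + t + 1"]
    by force
  ultimately show ?thesis using False x y by (auto simp: bead_def)
next
  case True
  define t where "t = nat (- k - 1)"
  have k: "k = - int t - 1" using True by (simp add: t_def)
  define x y where "x = nat (diagonal_length c k)" and "y = nat (diagonal_length c (k + 1))"
  have x: "diagonal_length c k = int x" and y: "diagonal_length c (k + 1) = int y"
    by (simp_all add: x_def y_def diagonal_length_nonneg)
  have d: "(s + t + 1, s) \<in> c \<longleftrightarrow> s < x" "(s + t, s) \<in> c \<longleftrightarrow> s < y" for s
  proof -
    have "int s - int (s + t + 1) = k" "int s - int (s + t) = k + 1" by (simp_all add: k)
    then show "(s + t + 1, s) \<in> c \<longleftrightarrow> s < x" "(s + t, s) \<in> c \<longleftrightarrow> s < y"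
      using mem_iff_less_diagonal_length[OF assms, of "s + t + 1" s]
        mem_iff_less_diagonal_length[OF assms, of "s + t" s] x y by simp_all
  qed
  have "x \<le> y"
    using d(1)[of y] d(2)[of y] partition_diagram_down[OF assms, of "y + t + 1" y "y + t" y]
    by force
  moreover have "y \<le> x + 1"
    using d(2)[of "Suc x"] d(1)[of x]
      partition_diagram_down[OF assms, of "Suc x + t" "Suc x" "x + t + 1" x]
    by force
  ultimately show ?thesis using True x y by (auto simp: bead_def)
qed

lemma partition_diagram_eqI:
  assumes "partition_diagram c" and "partition_diagram c'"
    and "\<And>k. diagonal_length c k = diagonal_length c' k"
  shows "c = c'"
  using assms(3) mem_iff_less_diagonal_length[OF assms(1)] mem_iff_less_diagonal_length[OF assms(2)]
  by (metis subrelI subset_antisym)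

lemma remove_corner_iff:
  assumes "partition_diagram c" and "(i, j) \<in> c"
  shows "partition_diagram (c - {(i, j)}) \<longleftrightarrow> (Suc i, j) \<notin> c \<and> (i, Suc j) \<notin> c"
proof
  assume "partition_diagram (c - {(i, j)})"
  from partition_diagram_down[OF this, of "Suc i" j i j]
    partition_diagram_down[OF this, of i "Suc j" i j]
  show "(Suc i, j) \<notin> c \<and> (i, Suc j) \<notin> c" by auto
next
  assume max: "(Suc i, j) \<notin> c \<and> (i, Suc j) \<notin> c"
  have "(i', j') \<noteq> (i, j)"
    if "(i1, j1) \<in> c" "(i1, j1) \<noteq> (i, j)" "i' \<le> i1" "j' \<le> j1" for i1 j1 i' j'
  proof
    assume "(i', j') = (i, j)"
    then have "Suc i \<le> i1 \<and> j \<le> j1 \<or> i \<le> i1 \<and> Suc j \<le> j1" using that by auto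
    then show False using partition_diagram_down[OF assms(1) that(1)] max by blast
  qed
  then show "partition_diagram (c - {(i, j)})"
    using assms(1) unfolding partition_diagram_def by blast
qed

lemma add_corner_iff:
  assumes "partition_diagram c" and "(i, j) \<notin> c"
  shows "partition_diagram (insert (i, j) c) \<longleftrightarrow>
    (i = 0 \<or> (i - 1, j) \<in> c) \<and> (j = 0 \<or> (i, j - 1) \<in> c)"
proof
  assume "partition_diagram (insert (i, j) c)"
  from partition_diagram_down[OF this, of i j "i - 1" j]
    partition_diagram_down[OF this, of i j i "j - 1"]
  show "(i = 0 \<or> (i - 1, j) \<in> c) \<and> (j = 0 \<or> (i, j - 1) \<in> c)" by auto
next
  assume nb: "(i = 0 \<or> (i - 1, j) \<in> c) \<and> (j = 0 \<or> (i, j - 1) \<in> c)"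
  have "(i', j') \<in> c" if "i' \<le> i" "j' \<le> j" "(i', j') \<noteq> (i, j)" for i' j'
  proof (cases "i' = i")
    case True
    then show ?thesis using that nb partition_diagram_down[OF assms(1), of i "j - 1" i j'] by auto
  next
    case False
    then show ?thesis using that nb partition_diagram_down[OF assms(1), of "i - 1" j i' j'] by auto
  qed
  then show "partition_diagram (insert (i, j) c)"
    using assms(1) unfolding partition_diagram_def by blast
qed

text \<open>
  The box at position \<open>t\<close>, counted from 0, on the diagonal of content \<open>k\<close>.
\<close>

definition diagonal_box :: "int \<Rightarrow> int \<Rightarrow> box" where
  "diagonal_box k t = (nat (t + max 0 (- k)), nat (t + max 0 k))"

text \<open>
  Only the last box of a diagonal can be removable, and it is so exactly when both neighbouring
  diagonals are too short to contain its right and lower neighbours: a bead follows a gap.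
\<close>

lemma removable_on_diagonal:
  assumes "partition_diagram c"
  shows "{b \<in> c. partition_diagram (c - {b}) \<and> content b = k} =
    (if bead c (k - 1) = 0 \<and> bead c k = 1 then {diagonal_box k (diagonal_length c k - 1)} else {})"
    (is "?L = ?R")
proof -
  have "(i, j) \<in> ?L \<longleftrightarrow> (i, j) \<in> ?R" for i j
  proof (cases "int j - int i = k")
    case False
    then show ?thesis
      by (auto simp: content_def diagonal_box_def max_def split: if_splits)
        (use diagonal_length_nonneg[of c "k - 1"] diagonal_length_nonneg[of c "k + 1"]
          in \<open>auto simp: bead_def split: if_splits\<close>)
  next
    case True
    note m = mem_iff_less_diagonal_length[OF assms]
    have e: "int (Suc j) - int i = k + 1" "int j - int (Suc i) = k - 1" using True by auto
    have "(i, j) \<in> ?L \<longleftrightarrow> int (min i j) < diagonal_length c k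
       \<and> diagonal_length c (k - 1) \<le> int (min (Suc i) j)
       \<and> diagonal_length c (k + 1) \<le> int (min i (Suc j))"
      using remove_corner_iff[OF assms, of i j] m[of i j] m[of "Suc i" j] m[of i "Suc j"] True
      unfolding e by (auto simp: content_def)
    also have "\<dots> \<longleftrightarrow> (i, j) \<in> ?R"
      using bead_0_or_1[OF assms, of k] bead_0_or_1[OF assms, of "k - 1"] True
        diagonal_length_nonneg[of c k] diagonal_length_nonneg[of c "k-1"]
        diagonal_length_nonneg[of c "k+1"]
      by (auto simp: bead_def diagonal_box_def min_def max_def split: if_splits)
    finally show ?thesis .
  qed
  then show ?thesis by (rule box_set_eqI)
qed

text \<open>
  The mirror image of the previous lemma: adding a box moves a bead one position up.
\<close>

lemma addable_on_diagonal:
  assumes "partition_diagram c"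
  shows "{b. b \<notin> c \<and> partition_diagram (insert b c) \<and> content b = k} =
    (if bead c (k - 1) = 1 \<and> bead c k = 0 then {diagonal_box k (diagonal_length c k)} else {})"
    (is "?L = ?R")
proof -
  have "(i, j) \<in> ?L \<longleftrightarrow> (i, j) \<in> ?R" for i j
  proof (cases "int j - int i = k")
    case False
    then show ?thesis
      by (auto simp: content_def diagonal_box_def max_def split: if_splits)
        (use diagonal_length_nonneg[of c k] bead_0_or_1[OF assms, of k] in \<open>auto simp: bead_def\<close>)
  next
    case True
    note m = mem_iff_less_diagonal_length[OF assms]
    have "i = 0 \<or> (i - 1, j) \<in> c \<longleftrightarrow> i = 0 \<or> int (min (i - 1) j) < diagonal_length c (k + 1)"
      using m[of "i - 1" j] True by (cases i) (auto simp: algebra_simps)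
    moreover have "j = 0 \<or> (i, j - 1) \<in> c \<longleftrightarrow> j = 0 \<or> int (min i (j - 1)) < diagonal_length c (k - 1)"
    proof (cases j)
      case (Suc j')
      then have "int j' - int i = k - 1" using True by simp
      with Suc m[of i j'] show ?thesis by simp
    qed simp
    ultimately have "(i, j) \<in> ?L \<longleftrightarrow> diagonal_length c k \<le> int (min i j)
       \<and> (i = 0 \<or> int (min (i - 1) j) < diagonal_length c (k + 1))
       \<and> (j = 0 \<or> int (min i (j - 1)) < diagonal_length c (k - 1))"
      using add_corner_iff[OF assms, of i j] m[of i j] True by (auto simp: content_def)
    also have "\<dots> \<longleftrightarrow> (i, j) \<in> ?R"
      using bead_0_or_1[OF assms, of k] bead_0_or_1[OF assms, of "k - 1"] True
        diagonal_length_nonneg[of c k] diagonal_length_nonneg[of c "k-1"]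
        diagonal_length_nonneg[of c "k+1"]
      by (cases i; cases j) (auto simp: bead_def diagonal_box_def min_def max_def split: if_splits)
    finally show ?thesis .
  qed
  then show ?thesis by (rule box_set_eqI)
qed

section \<open>Cores as diagrams with flush beads\<close>

text \<open>
  This is the abacus description of a core: on every runner the beads are pushed down without gaps.
  That the reflections preserve this property is visible from their action on beads, whereas it is
  hidden in terms of hook lengths.
\<close>

definition flush :: "nat \<Rightarrow> box set \<Rightarrow> bool" where
  "flush n c \<longleftrightarrow> partition_diagram c \<and> (\<forall>k. bead c k \<le> bead c (k - 2 * int n))"

text \<open>
  A bead at \<open>k\<close> is the vertical step that ends a row, namely the row \<open>i\<close> of length \<open>i + k + 1\<close>.
\<close>

lemma row_of_bead:
  assumes "partition_diagram c" and "bead c k = 1"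
  obtains i where "\<And>j. (i, j) \<in> c \<longleftrightarrow> int j < int i + k + 1"
proof -
  \<comment> \<open>Row \<open>i\<close> stops just before diagonal \<open>k + 1\<close>, whose boxes therefore fill the rows above \<open>i\<close>,
    beginning with row 0, or with row \<open>- k - 1\<close> if the content \<open>k + 1\<close> is negative.\<close>
  define i where "i = nat (diagonal_length c (k + 1) + max 0 (- k - 1))"
  have i: "int i = diagonal_length c (k + 1) + max 0 (- k - 1)"
    by (simp add: i_def diagonal_length_nonneg)
  have ge: "0 \<le> int i + k + 1"
    using i diagonal_length_nonneg[of c "k + 1"] by (simp add: max_def split: if_splits)
  have out: "(i, nat (int i + k + 1)) \<notin> c"
    using mem_iff_less_diagonal_length[OF assms(1), of i "nat (int i + k + 1)"] i ge
    by (auto simp: min_def max_def split: if_splits)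
  have end_in: "(i, nat (int i + k)) \<in> c" if "0 \<le> int i + k"
    using mem_iff_less_diagonal_length[OF assms(1), of i "nat (int i + k)"] i that assms(2)
      diagonal_length_nonneg[of c "k + 1"]
    by (auto simp: bead_def min_def max_def split: if_splits)
  have "(i, j) \<in> c \<longleftrightarrow> int j < int i + k + 1" for j
  proof (cases "int j < int i + k + 1")
    case True
    then show ?thesis
      using partition_diagram_down[OF assms(1) end_in, of i j] by auto
  next
    case False
    then have "nat (int i + k + 1) \<le> j" by linarith
    then show ?thesis
      using partition_diagram_down[OF assms(1), of i j i "nat (int i + k + 1)"] out False by auto
  qed
  then show ?thesis by (rule that)
qed

text \<open>
  Dually, a gap at \<open>k\<close> is the horizontal step that ends a column, of length \<open>j - k\<close> for column \<open>j\<close>.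
\<close>

lemma column_of_gap:
  assumes "partition_diagram c" and "bead c k = 0"
  obtains j where "\<And>i. (i, j) \<in> c \<longleftrightarrow> int i < int j - k"
proof -
  define j where "j = nat (diagonal_length c k + max 0 k)"
  have j: "int j = diagonal_length c k + max 0 k"
    by (simp add: j_def diagonal_length_nonneg)
  have ge: "0 \<le> int j - k"
    using j diagonal_length_nonneg[of c k] by (simp add: max_def split: if_splits)
  have out: "(nat (int j - k), j) \<notin> c"
    using mem_iff_less_diagonal_length[OF assms(1), of "nat (int j - k)" j] j ge
    by (auto simp: min_def max_def split: if_splits)
  have end_in: "(nat (int j - k - 1), j) \<in> c" if "0 \<le> int j - k - 1"
    using mem_iff_less_diagonal_length[OF assms(1), of "nat (int j - k - 1)" j] j that assms(2)
      diagonal_length_nonneg[of c k]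
    by (auto simp: bead_def min_def max_def add.commute split: if_splits)
  have "(i, j) \<in> c \<longleftrightarrow> int i < int j - k" for i
  proof (cases "int i < int j - k")
    case True
    then show ?thesis
      using partition_diagram_down[OF assms(1) end_in, of i j] by auto
  next
    case False
    then have "nat (int j - k) \<le> i" by linarith
    then show ?thesis
      using partition_diagram_down[OF assms(1), of i j "nat (int j - k)" j] out False by auto
  qed
  then show ?thesis by (rule that)
qed

text \<open>
  A bead at \<open>k\<close> together with a gap at \<open>k - 2n\<close> gives a row and a column whose common box has hook
  length equal to the distance \<open>2n\<close>.
\<close>

lemma core_is_flush:
  assumes "c \<in> cores (2 * n)"
  shows "flush n c"
proof -
  have c: "partition_diagram c" and hook: "\<And>b. b \<in> c \<Longrightarrow> hook_length c b \<noteq> 2 * n"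
    using assms by (auto simp: cores_def)
  have "bead c k \<le> bead c (k - 2 * int n)" for k
  proof (rule ccontr)
    assume "\<not> ?thesis"
    then have 1: "bead c k = 1" and 0: "bead c (k - 2 * int n) = 0"
      using bead_0_or_1[OF c, of k] bead_0_or_1[OF c, of "k - 2 * int n"] by auto
    obtain i where row: "\<And>j. (i, j) \<in> c \<longleftrightarrow> int j < int i + k + 1"
      using row_of_bead[OF c 1] by blast
    obtain j where col: "\<And>i. (i, j) \<in> c \<longleftrightarrow> int i < int j - (k - 2 * int n)"
      using column_of_gap[OF c 0] by blast
    have box: "(i, j) \<in> c"
      using row[of j] col[of i] by linarith
    have "{j'. j < j' \<and> (i, j') \<in> c} = {j<..<nat (int i + k + 1)}"
      unfolding row by auto
    moreover have "{i'. i < i' \<and> (i', j) \<in> c} = {i<..<nat (int j - (k - 2 * int n))}"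
      unfolding col by auto
    ultimately have "hook_length c (i, j) = 2 * n"
      using row[of j] col[of i] box by (simp add: hook_length_def)
    with hook[OF box] show False by simp
  qed
  with c show ?thesis by (simp add: flush_def)
qed

lemma flush_partition_diagram: "flush n c \<Longrightarrow> partition_diagram c"
  by (simp add: flush_def)

lemma flush_bead_antitone:
  assumes "flush n c" and "k mod (2 * int n) = k' mod (2 * int n)" and "k' \<le> k"
  shows "bead c k \<le> bead c k'"
proof -
  have step: "bead c x \<le> bead c (x - int m * (2 * int n))" for m x
  proof (induction m)
    case (Suc m)
    have "bead c (x - int m * (2 * int n)) \<le> bead c (x - int m * (2 * int n) - 2 * int n)"
      using assms(1) by (simp add: flush_def)
    with Suc show ?case by (simp add: algebra_simps)
  qed simp
  have "2 * int n dvd k - k'" using assms(2) by (simp add: mod_eq_dvd_iff)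
  then obtain q where q: "k - k' = 2 * int n * q" ..
  show ?thesis
  proof (cases "q \<ge> 0")
    case True
    then show ?thesis using step[of k "nat q"] q by (simp add: algebra_simps)
  next
    case False
    then have "2 * int n * q \<le> 0" by (simp add: mult_le_0_iff)
    with q assms(3) have "k = k'" by linarith
    then show ?thesis by simp
  qed
qed

text \<open>
  A core has no removable node at \<open>k\<close> together with an addable one at \<open>k'\<close> of the same residue. If
  \<open>k' \<le> k\<close>, the bead at \<open>k\<close> would lie above the gap at \<open>k'\<close> on one runner; otherwise the bead at
  \<open>k' - 1\<close> would lie above the gap at \<open>k - 1\<close> on the neighbouring runner.
\<close>

lemma flush_not_addable_and_removable:
  assumes "flush n c" and "k mod (2 * int n) = k' mod (2 * int n)"
    and "bead c (k - 1) = 0" and "bead c k = 1" and "bead c (k' - 1) = 1" and "bead c k' = 0"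
  shows False
proof (cases "k' \<le> k")
  case True
  then show ?thesis using flush_bead_antitone[OF assms(1,2)] assms(4,6) by simp
next
  case False
  moreover have "(k' - 1) mod (2 * int n) = (k - 1) mod (2 * int n)"
    using assms(2) by (metis mod_diff_left_eq)
  ultimately show ?thesis
    using flush_bead_antitone[OF assms(1), of "k' - 1" "k - 1"] assms(3,5) by simp
qed

lemma flush_empty: "flush n {}"
  by (simp add: flush_def partition_diagram_def bead_def)

section \<open>The reflections on beads\<close>

text \<open>
  No other box of the diagram lies weakly to the right of and below a removable box, so removable
  boxes can be removed together.
\<close>

lemma partition_diagram_diff_removable:
  assumes "partition_diagram c" and "\<And>b. b \<in> R \<Longrightarrow> b \<in> c \<and> partition_diagram (c - {b})"
  shows "partition_diagram (c - R)"
proof -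
  have "(i', j') \<notin> R" if "(i, j) \<in> c" "(i, j) \<notin> R" "i' \<le> i" "j' \<le> j" for i j i' j'
  proof
    assume R: "(i', j') \<in> R"
    then have "(i, j) \<in> c - {(i', j')}" using that by auto
    with assms(2)[OF R] that show False
      using partition_diagram_down[of "c - {(i', j')}" i j i' j'] by blast
  qed
  with assms(1) show ?thesis
    unfolding partition_diagram_def by (metis Diff_iff finite_Diff)
qed

lemma partition_diagram_union_addable:
  assumes "partition_diagram c" and "finite A" and "\<And>b. b \<in> A \<Longrightarrow> partition_diagram (insert b c)"
  shows "partition_diagram (c \<union> A)"
proof -
  have "(i', j') \<in> c \<union> A" if "(i, j) \<in> A" "i' \<le> i" "j' \<le> j" for i j i' j'
    using partition_diagram_down[OF assms(3)[OF that(1)], of i j i' j'] that by auto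
  with assms(1,2) show ?thesis
    unfolding partition_diagram_def by (metis Un_iff finite_Un)
qed

lemma removable_nodes_on_diagonal:
  assumes "partition_diagram c"
  shows "{b \<in> removable_nodes n i c. content b = k} =
    (if k mod (2 * int n) = int i \<and> bead c (k - 1) = 0 \<and> bead c k = 1
     then {diagonal_box k (diagonal_length c k - 1)} else {})"
proof -
  have "{b \<in> removable_nodes n i c. content b = k} =
    (if k mod (2 * int n) = int i
     then {b \<in> c. partition_diagram (c - {b}) \<and> content b = k} else {})"
    by (auto simp: removable_nodes_def residue_def content_def)
  then show ?thesis by (simp add: removable_on_diagonal[OF assms])
qed

lemma addable_nodes_on_diagonal:
  assumes "partition_diagram c"
  shows "{b \<in> addable_nodes n i c. content b = k} =
    (if k mod (2 * int n) = int i \<and> bead c (k - 1) = 1 \<and> bead c k = 0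
     then {diagonal_box k (diagonal_length c k)} else {})"
proof -
  have "{b \<in> addable_nodes n i c. content b = k} =
    (if k mod (2 * int n) = int i
     then {b. b \<notin> c \<and> partition_diagram (insert b c) \<and> content b = k} else {})"
    by (auto simp: addable_nodes_def residue_def content_def)
  then show ?thesis by (simp add: addable_on_diagonal[OF assms])
qed

lemma finite_support_diagonal_length:
  assumes "finite c"
  obtains K :: nat where "\<And>k. int K \<le> \<bar>k\<bar> \<Longrightarrow> diagonal_length c k = 0"
proof -
  define K where "K = Suc (Max (insert 0 ((\<lambda>b. nat \<bar>content b\<bar>) ` c)))"
  have K: "nat \<bar>content b\<bar> < K" if "b \<in> c" for b
    unfolding K_def using assms that by (auto simp: less_Suc_eq_le)
  have "diagonal_length c k = 0" if "int K \<le> \<bar>k\<bar>" for k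
    using K that unfolding diagonal_length_def by (fastforce intro: card_eq_0_iff[THEN iffD2])
  then show ?thesis by (rule that)
qed

text \<open>
  Far from the centre the beads agree with those of the empty diagram, which has its only addable
  node at content 0.
\<close>

lemma finite_addable_nodes:
  assumes "partition_diagram c"
  shows "finite (addable_nodes n i c)"
proof -
  obtain K :: nat where K: "\<And>k. int K \<le> \<bar>k\<bar> \<Longrightarrow> diagonal_length c k = 0"
    using finite_support_diagonal_length[OF partition_diagram_finite[OF assms]] by blast
  have "content b \<in> {- int K - 1..int K + 1}" if b: "b \<in> addable_nodes n i c" for b
  proof (rule ccontr)
    assume far: "content b \<notin> {- int K - 1..int K + 1}"
    have "{b' \<in> addable_nodes n i c. content b' = content b} \<noteq> {}" using b by blast
    then have "bead c (content b - 1) = 1" "bead c (content b) = 0"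
      unfolding addable_nodes_on_diagonal[OF assms] by (auto split: if_splits)
    then show False using far
      by (auto simp: bead_def K)
  qed
  then have "addable_nodes n i c \<subseteq>
      (\<Union>k\<in>{- int K - 1..int K + 1}. {b \<in> addable_nodes n i c. content b = k})"
    by blast
  moreover have "finite \<dots>"
    by (auto simp: addable_nodes_on_diagonal[OF assms])
  ultimately show ?thesis by (rule finite_subset)
qed

lemma partition_diagram_core_reflection:
  assumes "partition_diagram c"
  shows "partition_diagram (core_reflection n i c)"
proof -
  have "partition_diagram (c - removable_nodes n i c)"
    by (rule partition_diagram_diff_removable[OF assms]) (simp add: removable_nodes_def)
  moreover have "partition_diagram (c \<union> addable_nodes n i c)"
    by (rule partition_diagram_union_addable[OF assms finite_addable_nodes[OF assms]])
      (simp add: addable_nodes_def)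
  ultimately show ?thesis using assms by (simp add: core_reflection_def)
qed

text \<open>
  The case distinction in the definition of the reflection disappears. On a diagonal of residue \<open>i\<close>
  the difference \<open>bead c (k - 1) - bead c k\<close> is 1 at an addable node, -1 at a removable node and 0
  otherwise. Since the two kinds do not coexist on a core, all the nonzero differences
  have the same sign, and the reflection adds each difference to the length.
\<close>

lemma diagonal_length_core_reflection:
  assumes "flush n c"
  shows "diagonal_length (core_reflection n i c) k =
    diagonal_length c k + (if k mod (2 * int n) = int i then bead c (k - 1) - bead c k else 0)"
proof -
  note c = flush_partition_diagram[OF assms]
  note fin = partition_diagram_finite[OF c]
  note R = removable_nodes_on_diagonal[OF c, of n i]
  note A = addable_nodes_on_diagonal[OF c, of n i]
  note no_both = flush_not_addable_and_removable[OF assms]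
  have b01: "bead c x = 0 \<or> bead c x = 1" for x by (rule bead_0_or_1[OF c])
  have no_addable: "\<not> (bead c (x - 1) = 1 \<and> bead c x = 0)"
    if "removable_nodes n i c \<noteq> {}" "x mod (2 * int n) = int i" for x
  proof -
    from that(1) obtain b where "b \<in> removable_nodes n i c" by blast
    then have "{b' \<in> removable_nodes n i c. content b' = content b} \<noteq> {}" by blast
    then show ?thesis unfolding R using no_both[of "content b" x] that(2)
      by (auto split: if_splits)
  qed
  have no_removable: "\<not> (bead c (x - 1) = 0 \<and> bead c x = 1)"
    if "removable_nodes n i c = {}" "x mod (2 * int n) = int i" for x
    using R[of x] that by (auto split: if_splits)
  show ?thesis
  proof (cases "removable_nodes n i c = {}")
    case False
    let ?R = "{b \<in> removable_nodes n i c. content b = k}"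
    have "{b \<in> core_reflection n i c. content b = k} = {b \<in> c. content b = k} - ?R"
      using False by (auto simp: core_reflection_def)
    moreover have sub: "?R \<subseteq> {b \<in> c. content b = k}" by (auto simp: removable_nodes_def)
    moreover have finR: "finite ?R" by (simp add: R)
    moreover have "card ?R \<le> card {b \<in> c. content b = k}"
      by (rule card_mono[OF _ sub]) (simp add: fin)
    ultimately have "diagonal_length (core_reflection n i c) k = diagonal_length c k - int (card ?R)"
      by (simp add: diagonal_length_def card_Diff_subset)
    also have "int (card ?R) =
        (if k mod (2 * int n) = int i \<and> bead c (k - 1) = 0 \<and> bead c k = 1 then 1 else 0)"
      unfolding R by simp
    finally show ?thesis using no_addable[OF False, of k] b01[of k] b01[of "k - 1"] by auto
  next
    case True
    let ?A = "{b \<in> addable_nodes n i c. content b = k}"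
    have "{b \<in> core_reflection n i c. content b = k} = {b \<in> c. content b = k} \<union> ?A"
      using True by (auto simp: core_reflection_def)
    moreover have "{b \<in> c. content b = k} \<inter> ?A = {}" by (auto simp: addable_nodes_def)
    moreover have "finite ?A" by (simp add: A)
    ultimately have "diagonal_length (core_reflection n i c) k = diagonal_length c k + int (card ?A)"
      using fin by (simp add: diagonal_length_def card_Un_disjoint)
    also have "int (card ?A) =
        (if k mod (2 * int n) = int i \<and> bead c (k - 1) = 1 \<and> bead c k = 0 then 1 else 0)"
      unfolding A by simp
    finally show ?thesis using no_removable[OF True, of k] b01[of k] b01[of "k - 1"] by auto
  qed
qed

lemma succ_mod_neq:
  assumes "n \<ge> 1"
  shows "(k + 1) mod (2 * int n) \<noteq> k mod (2 * int n)"
proof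
  assume "(k + 1) mod (2 * int n) = k mod (2 * int n)"
  then have "2 * int n dvd 1" by (simp add: mod_eq_dvd_iff)
  then show False by (metis dvd_mult_left odd_one)
qed

text \<open>
  The reflection is the permutation of the integers that exchanges \<open>k - 1\<close> and \<open>k\<close> for \<open>k \<equiv> i\<close>.
\<close>

lemma bead_core_reflection:
  assumes "flush n c" and "n \<ge> 1"
  shows "bead (core_reflection n i c) k =
    (if k mod (2 * int n) = int i then bead c (k - 1)
     else if (k + 1) mod (2 * int n) = int i then bead c (k + 1) else bead c k)"
  using succ_mod_neq[OF assms(2), of k]
  by (auto simp: bead_def[of "core_reflection n i c"] diagonal_length_core_reflection[OF assms(1)])
    (simp_all add: bead_def)

lemma flush_core_reflection:
  assumes "flush n c" and "n \<ge> 1"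
  shows "flush n (core_reflection n i c)"
  unfolding flush_def
proof (intro conjI allI)
  show "partition_diagram (core_reflection n i c)"
    by (rule partition_diagram_core_reflection[OF flush_partition_diagram[OF assms(1)]])
next
  fix k
  have mono: "bead c x \<le> bead c (x - 2 * int n)" for x using assms(1) by (simp add: flush_def)
  have "(k - 2 * int n) mod (2 * int n) = k mod (2 * int n)"
    "(k - 2 * int n + 1) mod (2 * int n) = (k + 1) mod (2 * int n)"
    by (simp_all add: mod_eq_dvd_iff)
  then show "bead (core_reflection n i c) k \<le> bead (core_reflection n i c) (k - 2 * int n)"
    using mono[of k] mono[of "k + 1"] mono[of "k - 1"]
    by (simp add: bead_core_reflection[OF assms] algebra_simps)
qed

lemma core_reflection_involution:
  assumes "flush n c" and "n \<ge> 1"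
  shows "core_reflection n i (core_reflection n i c) = c"
proof (rule partition_diagram_eqI)
  fix k
  have "(k - 1) mod (2 * int n) \<noteq> k mod (2 * int n)"
    using succ_mod_neq[OF assms(2), of "k - 1"] by simp
  then show "diagonal_length (core_reflection n i (core_reflection n i c)) k = diagonal_length c k"
    by (auto simp: diagonal_length_core_reflection[OF flush_core_reflection[OF assms]]
        diagonal_length_core_reflection[OF assms(1)] bead_core_reflection[OF assms])
qed (use assms in \<open>simp_all add: flush_partition_diagram partition_diagram_core_reflection\<close>)

text \<open>
  If \<open>i\<close> and \<open>j\<close> are not adjacent modulo \<open>2n\<close>, the two permutations of bead positions have disjoint
  supports.
\<close>

lemma core_reflection_commute:
  assumes "flush n c" and "n \<ge> 1" and "i < 2 * n" and "j < 2 * n"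
    and "i \<noteq> j" and "Suc i mod (2 * n) \<noteq> j" and "Suc j mod (2 * n) \<noteq> i"
  shows "core_reflection n i (core_reflection n j c) = core_reflection n j (core_reflection n i c)"
proof (rule partition_diagram_eqI)
  fix k
  have succ: "(x + 1) mod (2 * int n) \<noteq> int q"
    if "x mod (2 * int n) = int p" "Suc p mod (2 * n) \<noteq> q" for x p q
  proof -
    have "(x + 1) mod (2 * int n) = (int p + 1) mod (2 * int n)"
      using that(1) by (metis mod_add_left_eq)
    also have "\<dots> = int (Suc p mod (2 * n))" by (simp add: of_nat_mod add.commute)
    finally show ?thesis using that(2) by simp
  qed
  have pred: "(x - 1) mod (2 * int n) \<noteq> int q"
    if "x mod (2 * int n) = int p" "Suc q mod (2 * n) \<noteq> p" for x p q
    using succ[of "x - 1" q p] that by auto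
  show "diagonal_length (core_reflection n i (core_reflection n j c)) k =
    diagonal_length (core_reflection n j (core_reflection n i c)) k"
    using succ[of k i j] succ[of k j i] pred[of k i j] pred[of k j i] assms(5-7)
    by (auto simp: diagonal_length_core_reflection[OF flush_core_reflection[OF assms(1,2)]]
        diagonal_length_core_reflection[OF assms(1)] bead_core_reflection[OF assms(1,2)])
qed (use assms in \<open>simp_all add: flush_partition_diagram partition_diagram_core_reflection\<close>)

section \<open>Conjugation\<close>

lemma mem_conjugate [simp]: "(i, j) \<in> conjugate c \<longleftrightarrow> (j, i) \<in> c"
  by (auto simp: conjugate_def)

lemma conjugate_eq_image: "conjugate c = prod.swap ` c"
  by (force simp: conjugate_def)

lemma partition_diagram_conjugate: "partition_diagram c \<Longrightarrow> partition_diagram (conjugate c)"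
  unfolding partition_diagram_def mem_conjugate
  by (auto simp: conjugate_eq_image simp del: mem_conjugate)

lemma diagonal_length_conjugate: "diagonal_length (conjugate c) k = diagonal_length c (- k)"
proof -
  have "{b \<in> conjugate c. content b = k} = prod.swap ` {b \<in> c. content b = - k}"
    by (auto simp: content_def image_iff)
  then show ?thesis by (simp add: diagonal_length_def card_image)
qed

text \<open>
  Conjugation reverses the boundary path and exchanges its vertical and horizontal steps.
\<close>

lemma bead_conjugate: "bead (conjugate c) k = 1 - bead c (- k - 1)"
  by (simp add: bead_def diagonal_length_conjugate)

lemma flush_conjugate:
  assumes "flush n c"
  shows "flush n (conjugate c)"
  unfolding flush_def
proof (intro conjI allI)
  fix k
  have "bead c (- k - 1 + 2 * int n) \<le> bead c (- k - 1 + 2 * int n - 2 * int n)"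
    using assms unfolding flush_def by blast
  moreover have "- (k - 2 * int n) - 1 = - k - 1 + 2 * int n" by simp
  ultimately show "bead (conjugate c) k \<le> bead (conjugate c) (k - 2 * int n)"
    by (simp only: bead_conjugate) simp
qed (use assms in \<open>simp add: flush_partition_diagram partition_diagram_conjugate\<close>)

lemma conjugate_core_reflection:
  assumes "flush n c" and "n \<ge> 1" and "i < 2 * n" and "j < 2 * n" and "(i + j) mod (2 * n) = 0"
  shows "conjugate (core_reflection n i c) = core_reflection n j (conjugate c)"
proof (rule partition_diagram_eqI)
  fix k
  have neg: "k mod (2 * int n) = int j" if "- k mod (2 * int n) = int i"
    "i < 2 * n" "j < 2 * n" "(i + j) mod (2 * n) = 0" for k i j
  proof -
    have "2 * int n dvd int i + int j"
      using that(4) by (metis mod_0_imp_dvd of_nat_add of_nat_dvd_iff of_nat_mult of_nat_numeral)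
    moreover have "2 * int n dvd - k - int i"
      using that(1,2) by (metis mod_eq_dvd_iff mod_mod_trivial)
    ultimately have "2 * int n dvd (int i + int j) + (- k - int i)"
      by (rule dvd_add)
    then have "int j mod (2 * int n) = k mod (2 * int n)"
      by (simp add: mod_eq_dvd_iff)
    then show ?thesis using that(3) by simp
  qed
  have "- k mod (2 * int n) = int i \<longleftrightarrow> k mod (2 * int n) = int j"
    using neg[of k i j] neg[of "- k" j i] assms by (auto simp: add.commute)
  then show "diagonal_length (conjugate (core_reflection n i c)) k =
      diagonal_length (core_reflection n j (conjugate c)) k"
    by (simp add: diagonal_length_conjugate diagonal_length_core_reflection[OF assms(1)]
        diagonal_length_core_reflection[OF flush_conjugate[OF assms(1)]] bead_conjugate)
qed (use assms in \<open>simp_all add: flush_partition_diagram partition_diagram_core_reflection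
      flush_conjugate partition_diagram_conjugate\<close>)

section \<open>Residue counts\<close>

definition node_count :: "nat \<Rightarrow> box set \<Rightarrow> nat \<Rightarrow> int" where
  "node_count n c i = int (card (nodes n i c))"

text \<open>
  The pairing of the weight \<open>\<Lambda>\<^sub>0 - \<Sum>\<^sub>j a\<^sub>j \<alpha>\<^sub>j\<close> with the coroot of index \<open>i\<close>, where \<open>a\<^sub>j\<close> are the
  residue counts of \<open>c\<close>.
\<close>

definition weight_pairing :: "nat \<Rightarrow> box set \<Rightarrow> nat \<Rightarrow> int" where
  "weight_pairing n c i = of_bool (i = 0) - 2 * node_count n c i
     + node_count n c ((i + 1) mod (2 * n)) + node_count n c ((i + 2 * n - 1) mod (2 * n))"

lemma node_count_eq_sum:
  assumes "finite c" and "finite S" and "\<And>k. k \<notin> S \<Longrightarrow> diagonal_length c k = 0"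
  shows "node_count n c i = (\<Sum>k\<in>S. of_bool (k mod (2 * int n) = int i) * diagonal_length c k)"
proof -
  define D where "D k = {b \<in> c. content b = k}" for k
  have "content b \<in> S" if "b \<in> c" for b
  proof (rule ccontr)
    assume "content b \<notin> S"
    then have "card (D (content b)) = 0"
      using assms(3) by (simp add: diagonal_length_def D_def)
    then have "D (content b) = {}" using assms(1) by (simp add: D_def)
    then show False using that unfolding D_def by blast
  qed
  then have nodes: "nodes n i c = (\<Union>k\<in>{k \<in> S. k mod (2 * int n) = int i}. D k)"
    by (auto simp: nodes_def residue_def content_def D_def)
  have "card (nodes n i c) = (\<Sum>k\<in>{k \<in> S. k mod (2 * int n) = int i}. card (D k))"
    unfolding nodes by (rule card_UN_disjoint) (use assms in \<open>auto simp: D_def\<close>)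
  then have "node_count n c i = (\<Sum>k\<in>{k \<in> S. k mod (2 * int n) = int i}. diagonal_length c k)"
    by (simp add: node_count_def diagonal_length_def D_def)
  also have "\<dots> = (\<Sum>k\<in>S. if k mod (2 * int n) = int i then diagonal_length c k else 0)"
    by (rule sum.inter_filter[OF assms(2)])
  also have "\<dots> = (\<Sum>k\<in>S. of_bool (k mod (2 * int n) = int i) * diagonal_length c k)"
    by (rule sum.cong) auto
  finally show ?thesis .
qed

lemma succ_mod_eq_iff:
  assumes "n \<ge> 1" and "i < 2 * n"
  shows "(k + 1) mod (2 * int n) = int i \<longleftrightarrow> k mod (2 * int n) = int ((i + 2 * n - 1) mod (2 * n))"
proof -
  have i: "int i = int i mod (2 * int n)" using assms(2) by simp
  have "int ((i + 2 * n - 1) mod (2 * n)) = (int i + 2 * int n - 1) mod (2 * int n)"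
    using assms(1) by (simp add: zmod_int of_nat_diff)
  also have "\<dots> = (int i - 1) mod (2 * int n)"
    by (simp add: mod_eq_dvd_iff)
  finally have e: "int ((i + 2 * n - 1) mod (2 * n)) = (int i - 1) mod (2 * int n)" .
  have "(k + 1) mod (2 * int n) = int i \<longleftrightarrow> 2 * int n dvd k + 1 - int i"
    by (subst i) (rule mod_eq_dvd_iff)
  also have "\<dots> \<longleftrightarrow> k mod (2 * int n) = (int i - 1) mod (2 * int n)"
    by (simp add: mod_eq_dvd_iff diff_diff_eq2)
  finally show ?thesis unfolding e .
qed

lemma pred_mod_eq_iff:
  assumes "n \<ge> 1" and "i < 2 * n"
  shows "(k - 1) mod (2 * int n) = int i \<longleftrightarrow> k mod (2 * int n) = int ((i + 1) mod (2 * n))"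
proof -
  have i: "int i = int i mod (2 * int n)" using assms(2) by simp
  have e: "int ((i + 1) mod (2 * n)) = (int i + 1) mod (2 * int n)"
    by (simp add: zmod_int add.commute)
  have "(k - 1) mod (2 * int n) = int i \<longleftrightarrow> 2 * int n dvd k - 1 - int i"
    by (subst i) (rule mod_eq_dvd_iff)
  also have "\<dots> \<longleftrightarrow> k mod (2 * int n) = (int i + 1) mod (2 * int n)"
    by (simp add: mod_eq_dvd_iff algebra_simps)
  finally show ?thesis unfolding e .
qed

text \<open>
  The bead difference at \<open>k\<close> is the second difference of the diagonal lengths, with an extra 1 at
  \<open>k = 0\<close>. Summed over a residue class it gives the pairing: the
  number of addable minus the number of removable nodes of that residue.
\<close>

lemma weight_pairing_eq_sum:
  assumes "finite c" and "n \<ge> 1" and "i < 2 * n"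
    and K: "\<And>k. int K \<le> \<bar>k\<bar> \<Longrightarrow> diagonal_length c k = 0"
  shows "weight_pairing n c i =
    (\<Sum>k\<in>{- int K..int K}. of_bool (k mod (2 * int n) = int i) * (bead c (k - 1) - bead c k))"
proof -
  let ?I = "{- int K..int K}"
  let ?on = "\<lambda>k. of_bool (k mod (2 * int n) = int i) :: int"
  let ?D = "diagonal_length c"
  have here: "(\<Sum>k\<in>?I. ?on k * ?D k) = node_count n c i"
    by (rule node_count_eq_sum[symmetric]) (use assms(1) K in auto)
  have "(\<Sum>k\<in>?I. ?on k * ?D (k - 1)) =
      (\<Sum>k\<in>{- int K - 1..int K - 1}. of_bool ((k + 1) mod (2 * int n) = int i) * ?D k)"
    by (rule sum.reindex_bij_witness[of _ "\<lambda>k. k + 1" "\<lambda>k. k - 1"]) auto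
  also have "\<dots> = node_count n c ((i + 2 * n - 1) mod (2 * n))"
    unfolding succ_mod_eq_iff[OF assms(2,3)]
    by (rule node_count_eq_sum[symmetric]) (use assms(1) K in auto)
  finally have left: "(\<Sum>k\<in>?I. ?on k * ?D (k - 1)) = node_count n c ((i + 2 * n - 1) mod (2 * n))" .
  have "(\<Sum>k\<in>?I. ?on k * ?D (k + 1)) =
      (\<Sum>k\<in>{- int K + 1..int K + 1}. of_bool ((k - 1) mod (2 * int n) = int i) * ?D k)"
    by (rule sum.reindex_bij_witness[of _ "\<lambda>k. k - 1" "\<lambda>k. k + 1"]) auto
  also have "\<dots> = node_count n c ((i + 1) mod (2 * n))"
    unfolding pred_mod_eq_iff[OF assms(2,3)]
    by (rule node_count_eq_sum[symmetric]) (use assms(1) K in auto)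
  finally have right: "(\<Sum>k\<in>?I. ?on k * ?D (k + 1)) = node_count n c ((i + 1) mod (2 * n))" .
  have "(\<Sum>k\<in>?I. ?on k * of_bool (k = 0)) = (\<Sum>k\<in>?I. if k = 0 then of_bool (i = 0) else (0 :: int))"
    by (rule sum.cong) auto
  then have zero: "(\<Sum>k\<in>?I. ?on k * of_bool (k = 0)) = (of_bool (i = 0) :: int)" by simp
  have "(\<Sum>k\<in>?I. ?on k * (bead c (k - 1) - bead c k)) =
      (\<Sum>k\<in>?I. ?on k * ?D (k - 1) + ?on k * ?D (k + 1) + ?on k * of_bool (k = 0)
        - 2 * (?on k * ?D k))"
    by (rule sum.cong) (auto simp: bead_def)
  also have "\<dots> = weight_pairing n c i"
    by (simp only: sum.distrib sum_subtractf sum_distrib_left[symmetric] here left right zero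
        weight_pairing_def)
  finally show ?thesis by simp
qed

text \<open>
  The combinatorial reflection has the same effect on residue counts as the linear reflection has on
  the coefficients of the simple roots.
\<close>

lemma node_count_core_reflection:
  assumes "flush n c" and "n \<ge> 1" and "i < 2 * n" and "j < 2 * n"
  shows "node_count n (core_reflection n i c) j =
    node_count n c j + (if j = i then weight_pairing n c i else 0)"
proof -
  note c = flush_partition_diagram[OF assms(1)]
  note fin = partition_diagram_finite[OF c]
  obtain K' :: nat where K': "\<And>k. int K' \<le> \<bar>k\<bar> \<Longrightarrow> diagonal_length c k = 0"
    using finite_support_diagonal_length[OF fin] by blast
  \<comment> \<open>One step beyond the support, as a reflection can lengthen diagonals next to it.\<close>
  define K where "K = Suc K'"
  have K: "diagonal_length c k = 0" if "int K \<le> \<bar>k\<bar>" for k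
    using that by (simp add: K_def K')
  let ?I = "{- int K..int K}"
  let ?on = "\<lambda>i k. of_bool (k mod (2 * int n) = int i) :: int"
  have outside: "diagonal_length c k = 0 \<and> bead c (k - 1) - bead c k = 0" if "k \<notin> ?I" for k
    using that by (auto simp: bead_def K_def K')
  have "node_count n (core_reflection n i c) j =
      (\<Sum>k\<in>?I. ?on j k * diagonal_length (core_reflection n i c) k)"
    by (rule node_count_eq_sum)
      (use outside partition_diagram_finite[OF partition_diagram_core_reflection[OF c]] in
        \<open>auto simp: diagonal_length_core_reflection[OF assms(1)]\<close>)
  also have "\<dots> = (\<Sum>k\<in>?I. ?on j k * diagonal_length c k
      + of_bool (j = i) * (?on i k * (bead c (k - 1) - bead c k)))"
    by (rule sum.cong) (auto simp: diagonal_length_core_reflection[OF assms(1)] algebra_simps)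
  also have "\<dots> = (\<Sum>k\<in>?I. ?on j k * diagonal_length c k)
      + of_bool (j = i) * (\<Sum>k\<in>?I. ?on i k * (bead c (k - 1) - bead c k))"
    by (simp only: sum.distrib sum_distrib_left)
  also have "(\<Sum>k\<in>?I. ?on j k * diagonal_length c k) = node_count n c j"
    by (rule node_count_eq_sum[symmetric]) (use fin outside in auto)
  also have "(\<Sum>k\<in>?I. ?on i k * (bead c (k - 1) - bead c k)) = weight_pairing n c i"
    by (rule weight_pairing_eq_sum[symmetric]) (use fin assms K in auto)
  finally show ?thesis by simp
qed

lemma card_eq_sum_node_count:
  assumes "finite c" and "n \<ge> 1"
  shows "int (card c) = (\<Sum>j<2 * n. node_count n c j)"
proof -
  have "\<exists>j<2 * n. residue n b = int j" for b
    by (rule exI[of _ "nat (residue n b)"]) (use assms(2) in \<open>simp add: residue_def nat_less_iff\<close>)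
  then have "c = (\<Union>j\<in>{..<2 * n}. nodes n j c)"
    by (auto simp: nodes_def)
  then have "card c = card (\<Union>j\<in>{..<2 * n}. nodes n j c)" by simp
  also have "\<dots> = (\<Sum>j<2 * n. card (nodes n j c))"
    by (rule card_UN_disjoint) (use assms(1) in \<open>auto simp: nodes_def\<close>)
  finally show ?thesis by (simp add: node_count_def)
qed

text \<open>
  A nonempty diagram has a removable node. For a core, no node of its residue is addable, so the
  pairing for this residue has only nonpositive contributions and a negative one.
\<close>

lemma negative_weight_pairing:
  assumes "flush n c" and "n \<ge> 1" and "c \<noteq> {}"
  obtains i where "i < 2 * n" and "weight_pairing n c i < 0"
proof -
  note c = flush_partition_diagram[OF assms(1)]
  note fin = partition_diagram_finite[OF c]
  define h where "h b = fst b + snd b" for b :: box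
  \<comment> \<open>A box that is farthest from the corner has no right or lower neighbour in \<open>c\<close>.\<close>
  obtain b where b: "b \<in> c" "\<And>b'. b' \<in> c \<Longrightarrow> h b' \<le> h b"
  proof -
    have "Max (h ` c) \<in> h ` c" using fin assms(3) by simp
    then obtain b where "b \<in> c" "h b = Max (h ` c)" by auto
    then show ?thesis using that[of b] fin by simp
  qed
  obtain x y where xy: "b = (x, y)" by fastforce
  define k0 where "k0 = content b"
  have "(Suc x, y) \<notin> c" "(x, Suc y) \<notin> c"
    using b(2)[of "(Suc x, y)"] b(2)[of "(x, Suc y)"] by (auto simp: h_def xy)
  then have "{b \<in> c. partition_diagram (c - {b}) \<and> content b = k0} \<noteq> {}"
    using remove_corner_iff[OF c, of x y] b(1) unfolding k0_def xy by blast
  then have k0: "bead c (k0 - 1) = 0" "bead c k0 = 1"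
    unfolding removable_on_diagonal[OF c] by (auto split: if_splits)
  define i where "i = nat (k0 mod (2 * int n))"
  have i: "k0 mod (2 * int n) = int i" "i < 2 * n"
    using assms(2) by (simp_all add: i_def nat_less_iff)
  obtain K' :: nat where K': "\<And>k. int K' \<le> \<bar>k\<bar> \<Longrightarrow> diagonal_length c k = 0"
    using finite_support_diagonal_length[OF fin] by blast
  \<comment> \<open>The window must contain \<open>k0\<close>, so that the strictly negative term occurs in the sum.\<close>
  define K where "K = max K' (nat \<bar>k0\<bar>)"
  have "weight_pairing n c i =
      (\<Sum>k\<in>{- int K..int K}. of_bool (k mod (2 * int n) = int i) * (bead c (k - 1) - bead c k))"
    by (rule weight_pairing_eq_sum) (use fin assms(2) i K' in \<open>auto simp: K_def\<close>)
  also have "\<dots> < (\<Sum>k\<in>{- int K..int K}. 0)"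
  proof (rule sum_strict_mono_ex1)
    show "\<forall>k\<in>{- int K..int K}.
        of_bool (k mod (2 * int n) = int i) * (bead c (k - 1) - bead c k) \<le> 0"
    proof
      fix k
      have "bead c (k - 1) - bead c k \<le> 0" if "k mod (2 * int n) = int i"
        using flush_not_addable_and_removable[OF assms(1) _ k0, of k] that i(1)
          bead_0_or_1[OF c, of k] bead_0_or_1[OF c, of "k - 1"] by auto
      then show "of_bool (k mod (2 * int n) = int i) * (bead c (k - 1) - bead c k) \<le> 0" by simp
    qed
    show "\<exists>k\<in>{- int K..int K}. of_bool (k mod (2 * int n) = int i) * (bead c (k - 1) - bead c k) < 0"
      by (rule bexI[of _ k0]) (use k0 i in \<open>auto simp: K_def\<close>)
  qed simp
  finally show ?thesis using that i(2) by simp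
qed

section \<open>The weight of a core\<close>

lemma lookup_simple_root:
  assumes "n \<ge> 1" and "i < 2 * n" and "j < 2 * n"
  shows "Poly_Mapping.lookup (simple_root n j) (Fund i) =
    2 * of_bool (j = i) - of_bool (j = (i + 2 * n - 1) mod (2 * n)) - of_bool (j = (i + 1) mod (2 * n))"
proof -
  have succ: "(int x + 1) mod (2 * int n) = int ((x + 1) mod (2 * n))" for x
    by (simp add: zmod_int add.commute)
  have small: "int x mod (2 * int n) = int x" if "x < 2 * n" for x
    using that by simp
  have "i = (j + 1) mod (2 * n) \<longleftrightarrow> j = (i + 2 * n - 1) mod (2 * n)"
    using succ_mod_eq_iff[OF assms(1,2), of "int j"]
    unfolding succ small[OF assms(3)] of_nat_eq_iff by metis
  moreover have "i = (j + 2 * n - 1) mod (2 * n) \<longleftrightarrow> j = (i + 1) mod (2 * n)"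
    using succ_mod_eq_iff[OF assms(1,3), of "int i"]
    unfolding succ small[OF assms(2)] of_nat_eq_iff by metis
  moreover have "Poly_Mapping.lookup (simple_root n j) (Fund i) =
      2 * of_bool (i = j) - of_bool (i = (j + 1) mod (2 * n)) - of_bool (i = (j + 2 * n - 1) mod (2 * n))"
  proof -
    have *: "Poly_Mapping.lookup (fundamental_weight k) (Fund i) = of_bool (i = k)" for k
      by (simp add: fundamental_weight_def)
    have null: "Poly_Mapping.lookup (if j = 0 then frag_of Null_Root else 0) (Fund i) = 0"
      by simp
    then show ?thesis
      unfolding simple_root_def lookup_add lookup_minus lookup_frag_cmul * null by (simp only: add_0_right)
  qed
  ultimately show ?thesis by (simp only: eq_commute[of j i])
qed

lemma lookup_sum_simple_roots:
  assumes "n \<ge> 1" and "i < 2 * n"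
  shows "Poly_Mapping.lookup (\<Sum>j<2 * n. frag_cmul (f j) (simple_root n j)) (Fund i) =
    2 * f i - f ((i + 2 * n - 1) mod (2 * n)) - f ((i + 1) mod (2 * n))"
proof -
  define p q where "p = (i + 2 * n - 1) mod (2 * n)" and "q = (i + 1) mod (2 * n)"
  have "p < 2 * n" "q < 2 * n" using assms(1) by (simp_all add: p_def q_def)
  have split: "x * (2 * of_bool P - of_bool Q - of_bool R) =
      (if P then 2 * x else 0) - (if Q then x else 0) - (if R then x else 0)" for x :: int and P Q R
    by (cases P; cases Q; cases R) simp_all
  have "Poly_Mapping.lookup (\<Sum>j<2 * n. frag_cmul (f j) (simple_root n j)) (Fund i) =
    (\<Sum>j<2 * n. f j * (2 * of_bool (j = i) - of_bool (j = p) - of_bool (j = q)))"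
    unfolding lookup_sum p_def q_def
    by (rule sum.cong) (simp_all only: lookup_frag_cmul lookup_simple_root[OF assms] lessThan_iff)
  also have "\<dots> = 2 * f i - f p - f q"
    unfolding split sum_subtractf
    using \<open>p < 2 * n\<close> \<open>q < 2 * n\<close> assms(2) by simp
  finally show ?thesis unfolding p_def q_def .
qed

lemma lookup_sum_simple_roots_Null_Root:
  assumes "n \<ge> 1"
  shows "Poly_Mapping.lookup (\<Sum>j<2 * n. frag_cmul (f j) (simple_root n j)) Null_Root = f 0"
proof -
  have "Poly_Mapping.lookup (fundamental_weight k) Null_Root = 0" for k
    by (simp add: fundamental_weight_def)
  then have root: "Poly_Mapping.lookup (simple_root n j) Null_Root = of_bool (j = 0)" for j
    unfolding simple_root_def lookup_add lookup_minus lookup_frag_cmul by simp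
  have "Poly_Mapping.lookup (\<Sum>j<2 * n. frag_cmul (f j) (simple_root n j)) Null_Root =
      (\<Sum>j<2 * n. if j = 0 then f j else 0)"
    unfolding lookup_sum by (rule sum.cong) (simp_all add: root)
  then show ?thesis using assms by simp
qed

text \<open>
  The coefficient of the null root shows that the difference \<open>h\<close> of the two families vanishes at
  index 0. The coefficients of the fundamental weights say that \<open>h\<close> is the mean of its two
  neighbours on the cycle of length \<open>2n\<close>, so \<open>h\<close> is linear, and closing the cycle makes its slope 0.
\<close>

lemma simple_roots_independent:
  assumes "n \<ge> 1"
    and "(\<Sum>j<2 * n. frag_cmul (f j) (simple_root n j)) = (\<Sum>j<2 * n. frag_cmul (g j) (simple_root n j))"
    and "j < 2 * n"
  shows "f j = g j"
proof -
  define h where "h j = f j - g j" for j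
  have h0: "h 0 = 0"
    using arg_cong[OF assms(2), of "\<lambda>x. Poly_Mapping.lookup x Null_Root"]
    by (simp add: lookup_sum_simple_roots_Null_Root[OF assms(1)] h_def)
  have balance: "2 * h i = h p + h q"
    if "i < 2 * n" "(i + 2 * n - 1) mod (2 * n) = p" "(i + 1) mod (2 * n) = q" for i p q
  proof -
    have "2 * f i - f p - f q = 2 * g i - g p - g q"
      using arg_cong[OF assms(2), of "\<lambda>x. Poly_Mapping.lookup x (Fund i)"]
      unfolding lookup_sum_simple_roots[OF assms(1) that(1)] that(2,3) .
    then show ?thesis by (simp add: h_def algebra_simps)
  qed
  have linear: "h j = int j * h 1 \<and> (Suc j < 2 * n \<longrightarrow> h (Suc j) = int (Suc j) * h 1)"
    if "j < 2 * n" for j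
    using that
  proof (induction j)
    case (Suc j)
    have "h (Suc (Suc j)) = int (Suc (Suc j)) * h 1" if "Suc (Suc j) < 2 * n"
    proof -
      have "(Suc j + 2 * n - 1) mod (2 * n) = j" "(Suc j + 1) mod (2 * n) = Suc (Suc j)"
        using Suc.prems that by simp_all
      then have "2 * h (Suc j) = h j + h (Suc (Suc j))"
        by (rule balance[OF Suc.prems])
      then show ?thesis using Suc by (simp add: algebra_simps)
    qed
    with Suc show ?case by simp
  qed (simp add: h0)
  define m where "m = 2 * n - 1"
  have m: "m < 2 * n" "(0 + 2 * n - 1) mod (2 * n) = m" "(0 + 1) mod (2 * n) = 1"
    using assms(1) by (simp_all add: m_def)
  have "h m + h 1 = 0" using balance[OF _ m(2,3)] m(1) h0 by simp
  then have "(int m + 1) * h 1 = 0" using linear[OF m(1)] by (simp add: distrib_right)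
  then have "h 1 = 0" by simp
  then show ?thesis using linear[OF assms(3)] by (simp add: h_def)
qed

lemma core_action_simps [simp]:
  "core_action n [] c = c"
  "core_action n (i # w) c = core_reflection n i (core_action n w c)"
  "core_action n (v @ w) c = core_action n v (core_action n w c)"
  by (simp_all add: core_action_def)

text \<open>
  The coefficients of \<open>\<Lambda>\<^sub>0 - w \<Lambda>\<^sub>0\<close> are the residue counts of \<open>w \<cdot> \<emptyset>\<close>; in particular they depend
  only on this diagram. Being flush is carried through the induction, as the reflection formula for
  residue counts holds for such diagrams only.
\<close>

lemma weight_action_fundamental_weight:
  assumes "n \<ge> 1" and "set w \<subseteq> {..<2 * n}"
  shows "flush n (core_action n w {}) \<and>
    weight_action n w (fundamental_weight 0) =
      fundamental_weight 0
        - (\<Sum>j<2 * n. frag_cmul (node_count n (core_action n w {}) j) (simple_root n j))"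
  using assms(2)
proof (induction w)
  case Nil
  then show ?case
    by (simp add: flush_empty weight_action_def node_count_def nodes_def)
next
  case (Cons i w)
  define c where "c = core_action n w {}"
  define x where "x = fundamental_weight 0
        - (\<Sum>j<2 * n. frag_cmul (node_count n c j) (simple_root n j))"
  have i: "i < 2 * n" and c: "flush n c" and x: "weight_action n w (fundamental_weight 0) = x"
    using Cons by (simp_all add: c_def x_def)
  have pairing: "coroot_pairing x i = weight_pairing n c i"
    by (simp add: x_def coroot_pairing_def lookup_minus lookup_sum_simple_roots[OF assms(1) i]
        fundamental_weight_def weight_pairing_def)
  have "weight_action n (i # w) (fundamental_weight 0) =
      x - frag_cmul (weight_pairing n c i) (simple_root n i)"
    using x by (simp add: weight_action_def weight_reflection_def pairing)
  also have "frag_cmul (weight_pairing n c i) (simple_root n i) =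
      (\<Sum>j<2 * n. if j = i then frag_cmul (weight_pairing n c i) (simple_root n j) else 0)"
    using i by simp
  also have "x - \<dots> = fundamental_weight 0
      - (\<Sum>j<2 * n. frag_cmul (node_count n c j) (simple_root n j)
          + (if j = i then frag_cmul (weight_pairing n c i) (simple_root n j) else 0))"
    by (simp add: x_def sum.distrib)
  also have "(\<Sum>j<2 * n. frag_cmul (node_count n c j) (simple_root n j)
          + (if j = i then frag_cmul (weight_pairing n c i) (simple_root n j) else 0)) =
      (\<Sum>j<2 * n. frag_cmul (node_count n (core_reflection n i c) j) (simple_root n j))"
    by (rule sum.cong)
      (auto simp: node_count_core_reflection[OF c assms(1) i] frag_cmul_distrib)
  finally show ?case
    using flush_core_reflection[OF c assms(1)] by (simp add: c_def)
qed

section \<open>Self-conjugate cores and their orbits\<close>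

definition symmetric_flush :: "nat \<Rightarrow> box set \<Rightarrow> bool" where
  "symmetric_flush n c \<longleftrightarrow> flush n c \<and> conjugate c = c"

lemma node_count_opposite:
  assumes "conjugate c = c" and "0 < i" and "i < 2 * n"
  shows "node_count n c (2 * n - i) = node_count n c i"
proof -
  have opp: "residue n (x, y) = int (2 * n - i) \<longleftrightarrow> residue n (y, x) = int i" for x y
  proof -
    have "residue n (x, y) = (- (int x - int y)) mod (2 * int n)"
      by (simp add: residue_def)
    also have "\<dots> = (if residue n (y, x) = 0 then 0 else 2 * int n - residue n (y, x))"
      unfolding residue_def zmod_zminus1_eq_if by simp
    finally show ?thesis using assms(2,3) by (auto simp: of_nat_diff)
  qed
  have "nodes n (2 * n - i) c = prod.swap ` nodes n i c"
  proof (rule box_set_eqI)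
    fix x y
    have "(x, y) \<in> c \<longleftrightarrow> (y, x) \<in> c" using mem_conjugate[of x y c] assms(1) by simp
    then show "(x, y) \<in> nodes n (2 * n - i) c \<longleftrightarrow> (x, y) \<in> prod.swap ` nodes n i c"
      using opp[of x y] by (force simp: nodes_def)
  qed
  then show ?thesis by (simp add: node_count_def card_image)
qed

lemma weight_pairing_opposite:
  assumes "conjugate c = c" and "0 < i" and "i < 2 * n"
  shows "weight_pairing n c (2 * n - i) = weight_pairing n c i"
proof -
  have "node_count n c ((2 * n - i + 1) mod (2 * n)) = node_count n c ((i + 2 * n - 1) mod (2 * n))"
  proof (cases "i = 1")
    case False
    then have "2 * n - i + 1 = 2 * n - (i - 1)" "2 * n - (i - 1) < 2 * n"
      using assms(2,3) by linarith+
    then have "(2 * n - i + 1) mod (2 * n) = 2 * n - (i - 1)"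
      by simp
    moreover have "(i + 2 * n - 1) mod (2 * n) = i - 1"
      using assms(2,3) by (simp add: mod_if)
    ultimately show ?thesis using node_count_opposite[OF assms(1), of "i - 1" n] False assms(2,3) by simp
  qed (use assms in simp)
  moreover have "node_count n c ((2 * n - i + 2 * n - 1) mod (2 * n)) = node_count n c ((i + 1) mod (2 * n))"
  proof (cases "i + 1 = 2 * n")
    case True
    then have "2 * n - i = 1" by simp
    with True show ?thesis by simp
  next
    case False
    then have "(2 * n - i + 2 * n - 1) mod (2 * n) = 2 * n - (i + 1)" "(i + 1) mod (2 * n) = i + 1"
      using assms(2,3) by (simp_all add: mod_if)
    then show ?thesis using node_count_opposite[OF assms(1), of "i + 1" n] False assms(2,3) by simp
  qed
  ultimately show ?thesis
    using assms node_count_opposite[OF assms] by (simp add: weight_pairing_def)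
qed

lemma symmetric_flush_reflection:
  assumes "symmetric_flush n c" and "n \<ge> 1" and "i = 0 \<or> i = n"
  shows "symmetric_flush n (core_reflection n i c)"
proof -
  have c: "flush n c" "conjugate c = c" using assms(1) by (simp_all add: symmetric_flush_def)
  have "conjugate (core_reflection n i c) = core_reflection n i (conjugate c)"
    by (rule conjugate_core_reflection[OF c(1)]) (use assms(2,3) in \<open>auto simp: mult_2[symmetric]\<close>)
  then show ?thesis
    using c flush_core_reflection[OF c(1) assms(2)] by (simp add: symmetric_flush_def)
qed

text \<open>
  Conjugation exchanges \<open>s\<^sub>i\<close> and \<open>s\<^sub>2\<^sub>n\<^sub>-\<^sub>i\<close>. These are distinct and commute, so their product preserves
  self-conjugacy, and each of them changes its own residue count by the common pairing.
\<close>

lemma symmetric_flush_reflection_pair: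
  assumes "symmetric_flush n c" and "1 \<le> i" and "i < n"
  defines "c' \<equiv> core_action n [2 * n - i, i] c"
  shows "symmetric_flush n c'" and "core_action n [i, 2 * n - i] c' = c"
    and "\<And>j. j < 2 * n \<Longrightarrow> node_count n c' j =
      node_count n c j + (if j = i \<or> j = 2 * n - i then weight_pairing n c i else 0)"
proof -
  let ?i' = "2 * n - i"
  have c: "flush n c" "conjugate c = c" using assms(1) by (simp_all add: symmetric_flush_def)
  have n: "n \<ge> 1" and i: "i < 2 * n" and i': "?i' < 2 * n" and neq: "?i' \<noteq> i"
    using assms(2,3) by simp_all
  have c': "c' = core_reflection n ?i' (core_reflection n i c)" by (simp add: c'_def)
  have ci: "flush n (core_reflection n i c)" by (rule flush_core_reflection[OF c(1) n])
  have sum0: "(i + ?i') mod (2 * n) = 0" "(?i' + i) mod (2 * n) = 0"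
    using i by simp_all
  have far: "Suc i mod (2 * n) \<noteq> ?i'" "Suc ?i' mod (2 * n) \<noteq> i"
  proof -
    have "Suc i < 2 * n" using assms(3) by linarith
    moreover have "Suc i \<noteq> ?i'" "Suc ?i' \<noteq> i \<and> (Suc ?i' = 2 * n \<longrightarrow> i \<noteq> 0)"
      using assms(2,3) by presburger+
    ultimately show "Suc i mod (2 * n) \<noteq> ?i'" "Suc ?i' mod (2 * n) \<noteq> i"
      using assms(2,3) by (auto simp: mod_if)
  qed
  have "conjugate c' = core_reflection n i (conjugate (core_reflection n i c))"
    unfolding c' by (rule conjugate_core_reflection[OF ci n i' i sum0(2)])
  also have "conjugate (core_reflection n i c) = core_reflection n ?i' c"
    using conjugate_core_reflection[OF c(1) n i i' sum0(1)] c(2) by simp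
  also have "core_reflection n i (core_reflection n ?i' c) = c'"
    unfolding c' by (rule core_reflection_commute[OF c(1) n i i' neq[symmetric] far])
  finally show "symmetric_flush n c'"
    using flush_core_reflection[OF ci n] by (simp add: symmetric_flush_def c')
  show "core_action n [i, ?i'] c' = c"
    by (simp add: c' core_reflection_involution[OF ci n] core_reflection_involution[OF c(1) n])
  have count: "node_count n (core_reflection n i c) j =
      node_count n c j + (if j = i then weight_pairing n c i else 0)" if "j < 2 * n" for j
    by (rule node_count_core_reflection[OF c(1) n i that])
  have "?i' \<noteq> 0" using i by simp
  have p: "weight_pairing n (core_reflection n i c) ?i' = weight_pairing n c i"
  proof -
    have "(?i' + 1) mod (2 * n) \<noteq> i" using far(2) by simp
    moreover have "(?i' + 2 * n - 1) mod (2 * n) \<noteq> i"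
    proof
      assume "(?i' + 2 * n - 1) mod (2 * n) = i"
      moreover have "?i' + 2 * n - 1 = (?i' - 1) + 2 * n" using i by simp
      moreover have "(?i' - 1 + 2 * n) mod (2 * n) = ?i' - 1"
        unfolding mod_add_self2 using i' by (intro mod_less) linarith
      ultimately have "?i' - 1 = i" by metis
      with far(1) i i' assms(3) show False by simp
    qed
    ultimately have "weight_pairing n (core_reflection n i c) ?i' = weight_pairing n c ?i'"
      using n neq i' unfolding weight_pairing_def by (simp add: count)
    then show ?thesis using weight_pairing_opposite[OF c(2), of i n] assms(2) i by simp
  qed
  show "node_count n c' j =
      node_count n c j + (if j = i \<or> j = ?i' then weight_pairing n c i else 0)" if "j < 2 * n" for j
    using neq unfolding c' node_count_core_reflection[OF ci n i' that] p count[OF that] by auto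
qed

lemma append_mem_weyl_words:
  assumes "g \<in> weyl_generators X n" and "w \<in> weyl_words X n"
  shows "g @ w \<in> weyl_words X n"
proof -
  obtain ws where "ws \<in> lists (weyl_generators X n)" "w = concat ws"
    using assms(2) by (auto simp: weyl_words_def)
  then show ?thesis
    using assms(1) unfolding weyl_words_def by (intro image_eqI[of _ _ "g # ws"]) auto
qed

lemma Nil_mem_weyl_words: "[] \<in> weyl_words X n"
  unfolding weyl_words_def by (rule image_eqI[of _ _ "[]"]) auto

lemma set_weyl_words:
  assumes "n \<ge> 1" and "w \<in> weyl_words X n"
  shows "set w \<subseteq> {..<2 * n}"
proof -
  have "set g \<subseteq> {..<2 * n}" if "g \<in> weyl_generators X n" for g
    using that assms(1) by (cases X) auto
  then show ?thesis using assms(2) by (fastforce simp: weyl_words_def)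
qed

lemma card_less_of_node_counts:
  assumes "finite c" and "finite c'" and "n \<ge> 1"
    and "\<And>j. j < 2 * n \<Longrightarrow> node_count n c' j \<le> node_count n c j"
    and "i < 2 * n" and "node_count n c' i < node_count n c i"
  shows "card c' < card c"
proof -
  have "(\<Sum>j<2 * n. node_count n c' j) < (\<Sum>j<2 * n. node_count n c j)"
    by (rule sum_strict_mono_ex1) (use assms in auto)
  then show ?thesis
    using card_eq_sum_node_count[OF assms(1,3)] card_eq_sum_node_count[OF assms(2,3)] by simp
qed

lemma symmetric_flush_finite: "symmetric_flush n c \<Longrightarrow> finite c"
  using flush_partition_diagram partition_diagram_finite unfolding symmetric_flush_def by blast

text \<open>
  One descent step for both types at once. A generator with indices different from 0 leaves the boxes
  of residue 0 alone, hence also their parity, which the odd type has to keep track of.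
\<close>

lemma descent_off_zero:
  assumes "symmetric_flush n c" and "n \<ge> 1" and "0 < i" and "i < 2 * n" and "weight_pairing n c i < 0"
  obtains c' g where "symmetric_flush n c'" and "card c' < card c"
    and "node_count n c' 0 = node_count n c 0"
    and "g \<in> weyl_generators X n" and "core_action n g c' = c"
proof -
  have c: "flush n c" "conjugate c = c" using assms(1) by (simp_all add: symmetric_flush_def)
  \<comment> \<open>Opposite residues have equal pairings, so the index can be folded into the range up to \<open>n\<close>.\<close>
  define m where "m = min i (2 * n - i)"
  have m: "1 \<le> m" "m \<le> n" "weight_pairing n c m < 0"
    using assms(3-5) weight_pairing_opposite[OF c(2) assms(3,4)] by (auto simp: m_def min_def)
  note fin = symmetric_flush_finite
  show ?thesis
  proof (cases "m = n")
    case True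
    let ?c' = "core_reflection n n c"
    have n: "n < 2 * n" using assms(2) by simp
    note count = node_count_core_reflection[OF c(1) assms(2) n]
    have sym: "symmetric_flush n ?c'"
      by (rule symmetric_flush_reflection) (use assms in auto)
    show ?thesis
    proof (rule that[of ?c' "[n]"])
      show "symmetric_flush n ?c'" by (rule sym)
      show "card ?c' < card c"
        by (rule card_less_of_node_counts[OF fin[OF assms(1)] fin[OF sym] assms(2) _ n])
          (use m True n in \<open>auto simp: count\<close>)
      show "node_count n ?c' 0 = node_count n c 0" using assms(2) by (simp add: count)
      show "[n] \<in> weyl_generators X n" by (cases X) auto
      show "core_action n [n] ?c' = c"
        by (simp add: core_reflection_involution[OF c(1) assms(2)])
    qed
  next
    case False
    then have mn: "m < n" using m by simp
    let ?c' = "core_action n [2 * n - m, m] c"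
    note pair = symmetric_flush_reflection_pair[OF assms(1) m(1) mn]
    show ?thesis
    proof (rule that[of ?c' "[m, 2 * n - m]"])
      show "symmetric_flush n ?c'" by (rule pair(1))
      show "card ?c' < card c"
        by (rule card_less_of_node_counts[OF fin[OF assms(1)] fin[OF pair(1)] assms(2), of m])
          (use m mn in \<open>auto simp: pair(3) simp del: core_action_simps\<close>)
      show "node_count n ?c' 0 = node_count n c 0"
        using pair(3)[of 0] m(1) mn by simp
      show "[m, 2 * n - m] \<in> weyl_generators X n" using m(1) mn by (cases X) auto
      show "core_action n [m, 2 * n - m] ?c' = c" by (rule pair(2))
    qed
  qed
qed

lemma symmetric_flush_in_even_orbit:
  assumes "n \<ge> 1" and "symmetric_flush n c"
  shows "\<exists>w\<in>weyl_words A2_even n. core_action n w {} = c"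
  using assms(2)
proof (induction "card c" arbitrary: c rule: less_induct)
  case less
  have c: "flush n c" using less.prems by (simp add: symmetric_flush_def)
  have step: ?case if "symmetric_flush n c'" "card c' < card c" "g \<in> weyl_generators A2_even n"
    "core_action n g c' = c" for c' g
  proof -
    from less.hyps[OF that(2,1)] obtain w
      where "w \<in> weyl_words A2_even n" "core_action n w {} = c'" by blast
    then show ?thesis
      using that(3,4) by (intro bexI[of _ "g @ w"] append_mem_weyl_words) auto
  qed
  show ?case
  proof (cases "c = {}")
    case True
    then show ?thesis using Nil_mem_weyl_words by force
  next
    case False
    obtain i where i: "i < 2 * n" "weight_pairing n c i < 0"
      using negative_weight_pairing[OF c assms(1) False] by blast
    show ?thesis
    proof (cases "i = 0")
      case True
      let ?c' = "core_reflection n 0 c"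
      have sym: "symmetric_flush n ?c'"
        by (rule symmetric_flush_reflection) (use assms less.prems in auto)
      show ?thesis
      proof (rule step[OF sym])
        show "card ?c' < card c"
          by (rule card_less_of_node_counts[OF symmetric_flush_finite[OF less.prems]
                symmetric_flush_finite[OF sym] assms(1), of 0])
            (use i True in \<open>auto simp: node_count_core_reflection[OF c assms(1)]\<close>)
        show "core_action n [0] ?c' = c"
          by (simp add: core_reflection_involution[OF c assms(1)])
      qed simp
    next
      case False
      then show ?thesis
        using descent_off_zero[OF less.prems assms(1) _ i, of A2_even] step by blast
    qed
  qed
qed

text \<open>
  Compared with the even type, \<open>s\<^sub>0\<close> alone is no longer available. If every \<open>p\<^sub>i\<close> with \<open>i \<noteq> 0\<close> is
  nonnegative, then \<open>p\<^sub>0 < 0\<close>. The element \<open>s\<^sub>0 s\<^sub>1 s\<^sub>2\<^sub>n\<^sub>-\<^sub>1 s\<^sub>0\<close> adds \<open>4(p\<^sub>0 + p\<^sub>1)\<close> boxes, of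
  which \<open>2(p\<^sub>0 + p\<^sub>1)\<close> have residue 0, so it preserves the parity of \<open>a\<^sub>0\<close> and is a descent unless
  \<open>p\<^sub>0 + p\<^sub>1 \<ge> 0\<close>. In that case all pairings of \<open>s\<^sub>0 c\<close> are nonnegative, so \<open>s\<^sub>0 c\<close> is
  empty and \<open>c\<close> is a single box, which is excluded because \<open>a\<^sub>0 = 1\<close> is odd.
\<close>

lemma symmetric_flush_in_odd_orbit:
  assumes "n \<ge> 2" and "symmetric_flush n c" and "even (node_count n c 0)"
  shows "\<exists>w\<in>weyl_words A2_odd n. core_action n w {} = c"
  using assms(2,3)
proof (induction "card c" arbitrary: c rule: less_induct)
  case less
  have c: "flush n c" "conjugate c = c" using less.prems by (simp_all add: symmetric_flush_def)
  have n: "n \<ge> 1" using assms(1) by simp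
  have step: ?case if "symmetric_flush n c'" "card c' < card c" "even (node_count n c' 0)"
    "g \<in> weyl_generators A2_odd n" "core_action n g c' = c" for c' g
  proof -
    from less.hyps[OF that(2,1,3)] obtain w
      where "w \<in> weyl_words A2_odd n" "core_action n w {} = c'" by blast
    then show ?thesis
      using that(4,5) by (intro bexI[of _ "g @ w"] append_mem_weyl_words) auto
  qed
  show ?case
  proof (cases "c = {}")
    case True
    then show ?thesis using Nil_mem_weyl_words by force
  next
    case nonempty: False
    show ?thesis
    proof (cases "\<exists>i. 0 < i \<and> i < 2 * n \<and> weight_pairing n c i < 0")
      case True
      then obtain i where i: "0 < i" "i < 2 * n" "weight_pairing n c i < 0" by blast
      show ?thesis
        using descent_off_zero[OF less.prems(1) n i, of A2_odd] step less.prems(2) by metis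
    next
      case False
      then have nonneg: "0 \<le> weight_pairing n c i" if "0 < i" "i < 2 * n" for i
        using that by force
      let ?p = "weight_pairing n c" and ?a = "node_count n c"
      have p0: "?p 0 < 0"
        using negative_weight_pairing[OF c(1) n nonempty] nonneg by (metis gr_zeroI linorder_not_le)
      let ?c1 = "core_reflection n 0 c"
      have f1: "flush n ?c1" by (rule flush_core_reflection[OF c(1) n])
      have s1: "symmetric_flush n ?c1"
        by (rule symmetric_flush_reflection) (use n less.prems in auto)
      have a1: "node_count n ?c1 j = ?a j + (if j = 0 then ?p 0 else 0)" if "j < 2 * n" for j
        by (rule node_count_core_reflection[OF c(1) n _ that]) (use n in simp)
      have last: "(2 * n - 1 + 1) mod (2 * n) = 0" "(0 + 2 * n - 1) mod (2 * n) = 2 * n - 1"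
        "(1 + 2 * n - 1) mod (2 * n) = 0" "(0 + 1) mod (2 * n) = 1" "(1 + 1) mod (2 * n) = 2"
        using assms(1) by simp_all
      have p1: "weight_pairing n ?c1 1 = ?p 1 + ?p 0"
        using assms(1) unfolding weight_pairing_def[of n _ 1] last by (simp add: a1)
      have opp: "?a (2 * n - 1) = ?a 1"
        using node_count_opposite[OF c(2), of 1 n] assms(1) by simp
      have p0_eq: "?p 0 = 1 - 2 * ?a 0 + 2 * ?a 1"
        unfolding weight_pairing_def[of n c 0] last opp by simp
      have neg: "?p 0 + ?p 1 < 0"
      proof (rule ccontr)
        assume ge: "\<not> ?thesis"
        have "0 \<le> weight_pairing n ?c1 i" if i: "i < 2 * n" for i
        proof -
          consider "i = 0" | "i = 1" | "i = 2 * n - 1" | "2 \<le> i" "i < 2 * n - 1"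
            using i by linarith
          then show ?thesis
          proof cases
            case 1
            have "weight_pairing n ?c1 0 = - ?p 0"
              unfolding weight_pairing_def[of n ?c1 0] last using assms(1) opp p0_eq by (simp add: a1)
            then show ?thesis using 1 p0 by simp
          next
            case 2
            then show ?thesis using p1 ge by simp
          next
            case 3
            then show ?thesis
              using weight_pairing_opposite[of ?c1 1 n] s1 p1 ge assms(1)
              by (simp add: symmetric_flush_def)
          next
            case 4
            then have "i + 1 < 2 * n" "i + 2 * n - 1 = (i - 1) + 2 * n" "i - 1 < 2 * n"
              by linarith+
            then have "(i + 1) mod (2 * n) = i + 1" "(i + 2 * n - 1) mod (2 * n) = i - 1"
              by (simp_all only: mod_add_self2 mod_less)
            then have "weight_pairing n ?c1 i = ?p i"
              unfolding weight_pairing_def using 4 by (simp add: a1)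
            then show ?thesis using nonneg 4 by simp
          qed
        qed
        then have "?c1 = {}"
          using negative_weight_pairing[OF f1 n] by (metis linorder_not_le)
        then have "?a 0 + ?p 0 = 0" "?a 1 = 0"
          using a1[of 0] a1[of 1] assms(1) by (simp_all add: node_count_def nodes_def)
        then have "?a 0 = 1" using p0_eq by simp
        then show False using less.prems(2) by simp
      qed
      let ?c3 = "core_action n [2 * n - 1, 1] ?c1"
      have "1 < n" using assms(1) by simp
      note pair = symmetric_flush_reflection_pair[OF s1 order_refl \<open>1 < n\<close>]
      have f3: "flush n ?c3" using pair(1) by (simp add: symmetric_flush_def)
      have a3: "node_count n ?c3 j = ?a j + (if j = 0 then ?p 0 else 0)
          + (if j = 1 \<or> j = 2 * n - 1 then ?p 1 + ?p 0 else 0)" if "j < 2 * n" for j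
        using pair(3)[OF that] a1[OF that] p1 by simp
      have p3: "weight_pairing n ?c3 0 = ?p 0 + 2 * ?p 1"
        unfolding weight_pairing_def[of n ?c3 0] last
        using assms(1) opp p0_eq a3[of 0] a3[of 1] a3[of "2 * n - 1"] by simp
      let ?c4 = "core_reflection n 0 ?c3"
      have s4: "symmetric_flush n ?c4"
        by (rule symmetric_flush_reflection[OF pair(1) n]) simp
      have a4: "node_count n ?c4 j = ?a j + (if j = 0 then 2 * (?p 0 + ?p 1) else 0)
          + (if j = 1 \<or> j = 2 * n - 1 then ?p 0 + ?p 1 else 0)" if "j < 2 * n" for j
        using node_count_core_reflection[OF f3 n _ that, of 0] n a3[OF that] p3 by auto
      show ?thesis
      proof (rule step[OF s4])
        show "card ?c4 < card c"
          by (rule card_less_of_node_counts[OF symmetric_flush_finite[OF less.prems(1)]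
                symmetric_flush_finite[OF s4] n, of 0])
            (use a4 neg n in auto)
        show "even (node_count n ?c4 0)" using a4[of 0] n less.prems(2) by simp
        show "[0, 1, 2 * n - 1, 0] \<in> weyl_generators A2_odd n" by simp
        have "core_action n [0, 1, 2 * n - 1, 0] ?c4 =
            core_reflection n 0 (core_action n [1, 2 * n - 1] (core_reflection n 0 ?c4))"
          by simp
        also have "core_reflection n 0 ?c4 = ?c3"
          by (rule core_reflection_involution[OF f3 n])
        also have "core_action n [1, 2 * n - 1] ?c3 = ?c1" by (rule pair(2))
        also have "core_reflection n 0 ?c1 = c" by (rule core_reflection_involution[OF c(1) n])
        finally show "core_action n [0, 1, 2 * n - 1, 0] ?c4 = c" .
      qed
    qed
  qed
qed

section \<open>Root coefficients\<close>

text \<open>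
  The coefficients on the untwisted simple roots of a combination of twisted ones of type \<open>A2_even\<close>.
\<close>

definition mirror_coeffs :: "nat \<Rightarrow> (nat \<Rightarrow> int) \<Rightarrow> nat \<Rightarrow> int" where
  "mirror_coeffs n a j = (if j < n then a j else if j = n then 2 * a n else a (2 * n - j))"

text \<open>
  For \<open>A2_odd\<close>, the root of index 0 contributes twice to the even root of index 0 and once to that
  of index 1.
\<close>

fun unfold_coeffs :: "twisted_type \<Rightarrow> nat \<Rightarrow> (nat \<Rightarrow> int) \<Rightarrow> nat \<Rightarrow> int" where
  "unfold_coeffs A2_even n a = mirror_coeffs n a"
| "unfold_coeffs A2_odd n a = mirror_coeffs n (a(0 := 2 * a 0, 1 := a 1 + a 0))"

lemma sum_twisted_roots:
  assumes "n \<ge> 2"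
  shows "(\<Sum>i\<le>n. frag_cmul (a i) (twisted_root X n i)) =
    (\<Sum>j<2 * n. frag_cmul (unfold_coeffs X n a j) (simple_root n j))"
proof -
  have even: "(\<Sum>i\<le>n. frag_cmul (a i) (root_A2_even n i)) =
    (\<Sum>j<2 * n. frag_cmul (unfold_coeffs A2_even n a j) (simple_root n j))" for a
  proof -
    let ?f = "\<lambda>j. frag_cmul (unfold_coeffs A2_even n a j) (simple_root n j)"
    let ?g = "\<lambda>i. frag_cmul (a i) (simple_root n i)"
    let ?h = "\<lambda>i. frag_cmul (a i) (simple_root n (2 * n - i))"
    have "{..n} = insert 0 (insert n {1..<n})" using assms by auto
    then have "(\<Sum>i\<le>n. frag_cmul (a i) (root_A2_even n i)) =
        ?g 0 + frag_cmul (2 * a n) (simple_root n n)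
          + (\<Sum>i\<in>{1..<n}. frag_cmul (a i) (root_A2_even n i))"
      using assms by (simp add: root_A2_even_def mult.commute)
    also have "(\<Sum>i\<in>{1..<n}. frag_cmul (a i) (root_A2_even n i)) = (\<Sum>i\<in>{1..<n}. ?g i + ?h i)"
      by (rule sum.cong) (simp_all add: root_A2_even_def frag_cmul_distrib2)
    also have "\<dots> = (\<Sum>i\<in>{1..<n}. ?g i) + (\<Sum>i\<in>{1..<n}. ?h i)"
      by (rule sum.distrib)
    also have "(\<Sum>i\<in>{1..<n}. ?g i) = (\<Sum>j\<in>{1..<n}. ?f j)"
      by (rule sum.cong) (simp_all add: mirror_coeffs_def)
    also have "(\<Sum>i\<in>{1..<n}. ?h i) = (\<Sum>j\<in>{n<..<2 * n}. ?f j)"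
      by (rule sum.reindex_bij_witness[of _ "\<lambda>j. 2 * n - j" "\<lambda>j. 2 * n - j"])
        (auto simp: mirror_coeffs_def)
    also have "?g 0 + frag_cmul (2 * a n) (simple_root n n)
          + ((\<Sum>j\<in>{1..<n}. ?f j) + (\<Sum>j\<in>{n<..<2 * n}. ?f j)) =
        (\<Sum>j\<in>insert 0 (insert n ({1..<n} \<union> {n<..<2 * n})). ?f j)"
    proof -
      have "(\<Sum>j\<in>{1..<n} \<union> {n<..<2 * n}. ?f j) = (\<Sum>j\<in>{1..<n}. ?f j) + (\<Sum>j\<in>{n<..<2 * n}. ?f j)"
        by (rule sum.union_disjoint) auto
      moreover have "?f 0 = ?g 0" "?f n = frag_cmul (2 * a n) (simple_root n n)"
        using assms by (simp_all add: mirror_coeffs_def)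
      ultimately show ?thesis using assms by (simp add: add.assoc del: unfold_coeffs.simps)
    qed
    also have "insert 0 (insert n ({1..<n} \<union> {n<..<2 * n})) = {..<2 * n}"
      using assms by auto
    finally show ?thesis .
  qed
  show ?thesis
  proof (cases X)
    case A2_even
    then show ?thesis using even[of a] by simp
  next
    case A2_odd
    let ?a = "a(0 := 2 * a 0, 1 := a 1 + a 0)"
    have split: "{..n} = insert 0 (insert 1 {2..n})" using assms by auto
    have "(\<Sum>i\<in>{2..n}. frag_cmul (a i) (twisted_root A2_odd n i)) =
        (\<Sum>i\<in>{2..n}. frag_cmul (?a i) (root_A2_even n i))"
      by (rule sum.cong) auto
    then have "(\<Sum>i\<le>n. frag_cmul (a i) (twisted_root A2_odd n i)) =
        (\<Sum>i\<le>n. frag_cmul (?a i) (root_A2_even n i))"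
      unfolding split
      by (simp add: frag_cmul_distrib frag_cmul_distrib2 mult.commute algebra_simps)
    then show ?thesis unfolding A2_odd even by (simp only: unfold_coeffs.simps)
  qed
qed

lemma twisted_roots_independent:
  assumes "n \<ge> 2"
    and "(\<Sum>i\<le>n. frag_cmul (a i) (twisted_root X n i)) = (\<Sum>i\<le>n. frag_cmul (b i) (twisted_root X n i))"
    and "i \<le> n"
  shows "a i = b i"
proof -
  have eq: "unfold_coeffs X n a j = unfold_coeffs X n b j" if "j < 2 * n" for j
    by (rule simple_roots_independent[OF _ assms(2)[unfolded sum_twisted_roots[OF assms(1)]] that])
      (use assms(1) in simp)
  have "unfold_coeffs X n a i = unfold_coeffs X n b i" "unfold_coeffs X n a 0 = unfold_coeffs X n b 0"
    using eq assms(1,3) by auto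
  then show ?thesis
    using assms(1,3) by (cases X) (auto simp: mirror_coeffs_def split: if_splits)
qed

text \<open>
  It suffices to exhibit one word for \<open>c\<close> and coefficients that unfold to the residue counts: the
  weight difference is the same for all words leading to \<open>c\<close>, and the twisted roots are independent.
\<close>

lemma root_coeffs_eqI:
  assumes "n \<ge> 2" and "w \<in> weyl_words X n" and "core_action n w {} = c"
    and "\<And>i. i > n \<Longrightarrow> a i = 0"
    and "\<And>j. j < 2 * n \<Longrightarrow> unfold_coeffs X n a j = node_count n c j"
  shows "root_coeffs X n c = a"
proof -
  have weight: "twisted_fundamental_weight_0 X - weight_action n v (twisted_fundamental_weight_0 X) =
      (\<Sum>i\<le>n. frag_cmul (a i) (twisted_root X n i))"
    if "v \<in> weyl_words X n" "core_action n v {} = c" for v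
  proof -
    have n: "n \<ge> 1" using assms(1) by simp
    have "twisted_fundamental_weight_0 X = fundamental_weight 0" by (cases X) simp_all
    then have "twisted_fundamental_weight_0 X - weight_action n v (twisted_fundamental_weight_0 X) =
        (\<Sum>j<2 * n. frag_cmul (node_count n c j) (simple_root n j))"
      using weight_action_fundamental_weight[OF n set_weyl_words[OF n that(1)]] that(2) by simp
    also have "\<dots> = (\<Sum>j<2 * n. frag_cmul (unfold_coeffs X n a j) (simple_root n j))"
      by (rule sum.cong) (simp_all add: assms(5))
    finally show ?thesis unfolding sum_twisted_roots[OF assms(1)] .
  qed
  show ?thesis
    unfolding root_coeffs_def
  proof (rule the_equality)
    show "(\<forall>i>n. a i = 0) \<and> (\<exists>w\<in>weyl_words X n. core_action n w {} = c \<and>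
        twisted_fundamental_weight_0 X - weight_action n w (twisted_fundamental_weight_0 X) =
          (\<Sum>i\<le>n. frag_cmul (a i) (twisted_root X n i)))"
      using assms(2-4) weight by blast
  next
    fix b
    assume b: "(\<forall>i>n. b i = 0) \<and> (\<exists>w\<in>weyl_words X n. core_action n w {} = c \<and>
        twisted_fundamental_weight_0 X - weight_action n w (twisted_fundamental_weight_0 X) =
          (\<Sum>i\<le>n. frag_cmul (b i) (twisted_root X n i)))"
    then have eq: "(\<Sum>i\<le>n. frag_cmul (b i) (twisted_root X n i)) =
        (\<Sum>i\<le>n. frag_cmul (a i) (twisted_root X n i))"
      using weight by metis
    show "b = a"
    proof
      fix i
      show "b i = a i"
        using twisted_roots_independent[OF assms(1) eq, of i] b assms(4) by (cases "i \<le> n") auto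
    qed
  qed
qed

section \<open>Parity of residue counts\<close>

lemma even_card_off_diagonal:
  assumes "finite A" and "\<And>i j. (i, j) \<in> A \<Longrightarrow> (j, i) \<in> A" and "\<And>i. (i, i) \<notin> A"
  shows "even (card (A :: box set))"
proof -
  define B where "B = {b \<in> A. fst b < snd b}"
  have "A = B \<union> prod.swap ` B"
  proof (rule box_set_eqI)
    fix i j
    show "(i, j) \<in> A \<longleftrightarrow> (i, j) \<in> B \<union> prod.swap ` B"
      using assms(2)[of i j] assms(2)[of j i] assms(3)[of i]
      by (cases i j rule: linorder_cases) (auto simp: B_def image_iff)
  qed
  moreover have "B \<inter> prod.swap ` B = {}" by (auto simp: B_def)
  moreover have "finite B" using assms(1) by (simp add: B_def)
  ultimately have "card A = card B + card (prod.swap ` B)"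
    by (metis card_Un_disjoint finite_imageI)
  then show ?thesis by (simp add: card_image)
qed

lemma residue_0_swap: "residue n (i, j) = 0 \<longleftrightarrow> residue n (j, i) = 0"
  by (simp add: residue_def mod_eq_0_iff_dvd dvd_diff_commute)

text \<open>
  Off the main diagonal, the boxes of residue 0 of a self-conjugate diagram come in transposed pairs.
\<close>

lemma even_node_count_0_iff:
  assumes "finite c" and "conjugate c = c"
  shows "even (node_count n c 0) \<longleftrightarrow> even (card {i. (i, i) \<in> c})"
proof -
  define D where "D = {b \<in> c. fst b = snd b}"
  define A where "A = {b \<in> nodes n 0 c. fst b \<noteq> snd b}"
  have sym: "(i, j) \<in> c \<longleftrightarrow> (j, i) \<in> c" for i j
    using mem_conjugate[of i j c] assms(2) by simp
  have "D = (\<lambda>i. (i, i)) ` {i. (i, i) \<in> c}" by (auto simp: D_def)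
  then have D: "card D = card {i. (i, i) \<in> c}" by (simp add: card_image inj_on_def)
  have "nodes n 0 c = D \<union> A" by (auto simp: D_def A_def nodes_def residue_def)
  moreover have "D \<inter> A = {}" "finite D" "finite A"
    using assms(1) by (auto simp: D_def A_def nodes_def)
  ultimately have "card (nodes n 0 c) = card D + card A"
    by (simp add: card_Un_disjoint)
  moreover have "even (card A)"
    by (rule even_card_off_diagonal)
      (use assms(1) sym residue_0_swap in \<open>auto simp: A_def nodes_def\<close>)
  ultimately show ?thesis using D by (simp add: node_count_def)
qed

text \<open>
  Transposition preserves residue \<open>n\<close>, because \<open>-n \<equiv> n\<close> modulo \<open>2n\<close>, and the boxes of the main
  diagonal have residue 0.
\<close>

lemma even_node_count_middle:
  assumes "finite c" and "conjugate c = c" and "n \<ge> 1"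
  shows "even (node_count n c n)"
proof -
  have sym: "(i, j) \<in> c \<longleftrightarrow> (j, i) \<in> c" for i j
    using mem_conjugate[of i j c] assms(2) by simp
  have swap: "residue n (j, i) = int n" if "residue n (i, j) = int n" for i j
  proof -
    have "residue n (j, i) = (- (int j - int i)) mod (2 * int n)" by (simp add: residue_def)
    also have "\<dots> = int n"
      using that assms(3) unfolding residue_def zmod_zminus1_eq_if by simp
    finally show ?thesis .
  qed
  have "even (card (nodes n n c))"
    by (rule even_card_off_diagonal)
      (use assms(1,3) sym swap in \<open>auto simp: nodes_def residue_def[of n "(i, i)" for i]\<close>)
  then show ?thesis by (simp add: node_count_def)
qed

theorem proposition5p11:
  fixes n :: nat and c :: "box set"
  assumes "n \<ge> 3"
    and "c \<in> even_self_conjugate_cores (2 * n)"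
  shows "atomic_length A2_odd n c = atomic_length A2_even n c - root_coeffs A2_even n c 0 \<and>
         real_of_int (atomic_length A2_even n c - root_coeffs A2_even n c 0)
           = 1 / 2 * (real (card c) - real (card (nodes n 0 c)))"
proof -
  have n: "n \<ge> 1" "n \<ge> 2" using assms(1) by simp_all
  have core: "c \<in> cores (2 * n)" and sym: "conjugate c = c" and diag: "even (card {i. (i, i) \<in> c})"
    using assms(2) by (simp_all add: even_self_conjugate_cores_def self_conjugate_cores_def)
  have c: "symmetric_flush n c"
    using core_is_flush[OF core] sym by (simp add: symmetric_flush_def)
  note fin = symmetric_flush_finite[OF c]
  let ?a = "node_count n c"
  have even0: "even (?a 0)" using even_node_count_0_iff[OF fin sym] diag by simp
  have evenn: "even (?a n)" by (rule even_node_count_middle[OF fin sym n(1)])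
  have opp: "?a (2 * n - j) = ?a j" if "0 < j" "j < 2 * n" for j
    by (rule node_count_opposite[OF sym that])
  define e where "e i = (if i < n then ?a i else if i = n then ?a n div 2 else 0)" for i
  define f where "f = e(0 := ?a 0 div 2, 1 := ?a 1 - ?a 0 div 2)"
  have unfold_e: "unfold_coeffs A2_even n e j = ?a j" if "j < 2 * n" for j
    using that evenn opp[of j] by (auto simp: e_def mirror_coeffs_def)
  \<comment> \<open>Halving \<open>a\<^sub>0\<close> is exact because it is even.\<close>
  have "f(0 := 2 * f 0, 1 := f 1 + f 0) = e"
    using even0 assms(1) by (auto simp: f_def e_def fun_eq_iff)
  then have unfold_f: "unfold_coeffs A2_odd n f j = ?a j" if "j < 2 * n" for j
    using unfold_e[OF that] by (simp only: unfold_coeffs.simps)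
  obtain v where "v \<in> weyl_words A2_even n" "core_action n v {} = c"
    using symmetric_flush_in_even_orbit[OF n(1) c] by blast
  then have e: "root_coeffs A2_even n c = e"
    by (rule root_coeffs_eqI[OF n(2)]) (use unfold_e in \<open>simp_all add: e_def\<close>)
  obtain w where "w \<in> weyl_words A2_odd n" "core_action n w {} = c"
    using symmetric_flush_in_odd_orbit[OF n(2) c even0] by blast
  then have f: "root_coeffs A2_odd n c = f"
    by (rule root_coeffs_eqI[OF n(2)]) (use unfold_f assms(1) in \<open>simp_all add: f_def e_def\<close>)
  have split: "{..n} = insert 0 (insert 1 {2..n})" using n by auto
  have "(\<Sum>i\<in>{2..n}. f i) = (\<Sum>i\<in>{2..n}. e i)"
    by (rule sum.cong) (auto simp: f_def)
  then have odd_even: "atomic_length A2_odd n c = atomic_length A2_even n c - root_coeffs A2_even n c 0"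
    unfolding atomic_length_def e f split using assms(1) by (simp add: f_def e_def)
  have "{..n} = insert 0 (insert n {1..<n})" using n by auto
  then have "atomic_length A2_even n c = ?a 0 + ?a n div 2 + (\<Sum>i\<in>{1..<n}. e i)"
    unfolding atomic_length_def e using n by (simp add: e_def)
  also have "(\<Sum>i\<in>{1..<n}. e i) = (\<Sum>i\<in>{1..<n}. ?a i)"
    by (rule sum.cong) (simp_all add: e_def)
  finally have "2 * (atomic_length A2_even n c - root_coeffs A2_even n c 0) =
      ?a n + 2 * (\<Sum>i\<in>{1..<n}. ?a i)"
    using evenn n unfolding e by (simp add: e_def)
  also have "\<dots> = int (card c) - ?a 0"
  proof -
    have "{..<2 * n} = insert 0 (insert n ({1..<n} \<union> {n<..<2 * n}))" using n by auto
    then have "int (card c) = ?a 0 + ?a n + (\<Sum>j\<in>{1..<n} \<union> {n<..<2 * n}. ?a j)"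
      unfolding card_eq_sum_node_count[OF fin n(1)] using n by simp
    also have "(\<Sum>j\<in>{1..<n} \<union> {n<..<2 * n}. ?a j) =
        (\<Sum>j\<in>{1..<n}. ?a j) + (\<Sum>j\<in>{n<..<2 * n}. ?a j)"
      by (rule sum.union_disjoint) auto
    also have "(\<Sum>j\<in>{n<..<2 * n}. ?a j) = (\<Sum>j\<in>{1..<n}. ?a j)"
      by (rule sum.reindex_bij_witness[of _ "\<lambda>j. 2 * n - j" "\<lambda>j. 2 * n - j"]) (auto simp: opp)
    finally show ?thesis by simp
  qed
  finally have "2 * real_of_int (atomic_length A2_even n c - root_coeffs A2_even n c 0) =
      real (card c) - real (card (nodes n 0 c))"
    unfolding node_count_def by linarith
  with odd_even show ?thesis by simp
qed

end
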